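(* Let $q\in(0,1)$, let $\pi:\mathcal{A}\to\mathcal{L}(L_2(h))$ be the representation of $\mathcal{A}=C(SU_q(2))$ by left multiplication on the $L_2$ space of the Haar state $h$, let $D$ be the equivariant Dirac operator on $L_2(h)$, and let $F=\operatorname{sign} D$. Let $T\in\pi(\mathcal{A})'$ (the commutant of $\pi(\mathcal{A})$ in $\mathcal{L}(L_2(h))$). If $[F,T]$ is compact, then $T$ is a scalar multiple of the identity.
   Context: Fix $q\in(0,1)$. $\mathcal{A}=C(SU_q(2))$ is the universal $C^*$-algebra generated by $\alpha,\beta$ subject to $\alpha^*\alpha+\beta^*\beta=I=\alpha\alpha^*+q^2\beta\beta^*$, $\alpha\beta=q\beta\alpha$, $\alpha\beta^*=q\beta^*\alpha$, $\beta^*\beta=\beta\beta^*$. $h$ is its Haar state, $L_2(h)$ the GNS Hilbert space, $\pi$ the representation by left multiplication. With $\mathbb{N}=\{0,1,2,\ldots\}$, $L_2(h)$ has a canonical orthonormal basis $\{e^{(n)}_{ij}: n\in\frac12\mathbb{N},\ i,j\in\{-n,-n+1,\ldots,n\}\}$ (normalized matrix entries of the irreducible representations; $e^{(0)}_{00}$ is the class of $1$), in which $$\pi(\alpha)e^{(n)}_{ij}=a_+(n,i,j)e^{(n+1/2)}_{i-1/2,j-1/2}+a_-(n,i,j)e^{(n-1/2)}_{i-1/2,j-1/2},$$ $$\pi(\beta)e^{(n)}_{ij}=b_+(n,i,j)e^{(n+1/2)}_{i+1/2,j-1/2}+b_-(n,i,j)e^{(n-1/2)}_{i+1/2,j-1/2},$$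 where (terms whose basis vector does not exist being read as $0$) $$a_+=\Bigl(q^{2(n+i)+2(n+j)+2}\tfrac{(1-q^{2n-2j+2})(1-q^{2n-2i+2})}{(1-q^{4n+2})(1-q^{4n+4})}\Bigr)^{1/2},\quad a_-=\Bigl(\tfrac{(1-q^{2n+2j})(1-q^{2n+2i})}{(1-q^{4n})(1-q^{4n+2})}\Bigr)^{1/2},$$ $$b_+=-\Bigl(q^{2(n+j)}\tfrac{(1-q^{2n-2j+2})(1-q^{2n+2i+2})}{(1-q^{4n+2})(1-q^{4n+4})}\Bigr)^{1/2},\quad b_-=\Bigl(q^{2(n+i)}\tfrac{(1-q^{2n+2j})(1-q^{2n-2i})}{(1-q^{4n})(1-q^{4n+2})}\Bigr)^{1/2}.$$ The equivariant Dirac operator is the self-adjoint operator $D$ diagonal in this basis, $De^{(n)}_{ij}=d(n,i)e^{(n)}_{ij}$, with $d(n,i)=2n+1$ if $i\neq n$ and $d(n,i)=-(2n+1)$ if $i=n$. Thus $F e^{(n)}_{ij}=e^{(n)}_{ij}$ if $i\ne n$ and $Fe^{(n)}_{ij}=-e^{(n)}_{ij}$ if $i=n$. *)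

theory Defs
  imports "HOL-Analysis.Analysis"
begin

section \<open>Complex Hilbert spaces and C*-algebras\<close>

class complex_vector = real_vector +
  fixes scaleC :: "complex \<Rightarrow> 'a \<Rightarrow> 'a" (infixr "*\<^sub>C" 75)
  assumes scaleC_add_right: "c *\<^sub>C (x + y) = c *\<^sub>C x + c *\<^sub>C y"
    and scaleC_add_left: "(c + d) *\<^sub>C x = c *\<^sub>C x + d *\<^sub>C x"
    and scaleC_scaleC: "c *\<^sub>C d *\<^sub>C x = (c * d) *\<^sub>C x"
    and scaleC_one: "1 *\<^sub>C x = x"
    and scaleC_of_real: "complex_of_real r *\<^sub>C x = r *\<^sub>R x"

text \<open>The complex inner product is linear in its second argument; the norm is the one induced by
  its real part, so that the real inner product library applies.\<close>

class chilbert_space = complex_vector + real_inner + complete_space +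
  fixes cinner :: "'a \<Rightarrow> 'a \<Rightarrow> complex"
  assumes cinner_add_right: "cinner x (y + z) = cinner x y + cinner x z"
    and cinner_scaleC_right: "cinner x (c *\<^sub>C y) = c * cinner x y"
    and cinner_commute: "cinner y x = cnj (cinner x y)"
    and inner_eq_Re_cinner: "inner x y = Re (cinner x y)"

text \<open>Unital and nonzero C*-algebras.\<close>

class cstar_algebra = complex_vector + real_normed_algebra_1 + complete_space +
  fixes star :: "'a \<Rightarrow> 'a"
  assumes mult_scaleC_left: "(c *\<^sub>C x) * y = c *\<^sub>C (x * y)"
    and mult_scaleC_right: "x * (c *\<^sub>C y) = c *\<^sub>C (x * y)"
    and norm_scaleC: "norm (c *\<^sub>C x) = cmod c * norm x"
    and star_star: "star (star x) = x"
    and star_add: "star (x + y) = star x + star y"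
    and star_scaleC: "star (c *\<^sub>C x) = cnj c *\<^sub>C star x"
    and star_mult: "star (x * y) = star y * star x"
    and cstar_identity: "norm (star x * x) = (norm x)\<^sup>2"

definition csubspace :: "'a::complex_vector set \<Rightarrow> bool" where
  "csubspace S \<longleftrightarrow> 0 \<in> S \<and> (\<forall>x\<in>S. \<forall>y\<in>S. x + y \<in> S) \<and> (\<forall>c. \<forall>x\<in>S. c *\<^sub>C x \<in> S)"

definition clinear_on :: "'a::complex_vector set \<Rightarrow> ('a \<Rightarrow> 'b::complex_vector) \<Rightarrow> bool" where
  "clinear_on S f \<longleftrightarrow> (\<forall>x\<in>S. \<forall>y\<in>S. f (x + y) = f x + f y) \<and> (\<forall>c. \<forall>x\<in>S. f (c *\<^sub>C x) = c *\<^sub>C f x)"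

text \<open>Orthonormal family whose closed complex linear span is the whole space.\<close>

definition orthonormal_basis_on :: "'i set \<Rightarrow> ('i \<Rightarrow> 'h::chilbert_space) \<Rightarrow> bool" where
  "orthonormal_basis_on I e \<longleftrightarrow>
     (\<forall>k\<in>I. \<forall>l\<in>I. cinner (e k) (e l) = (if k = l then 1 else 0)) \<and>
     (\<forall>S. csubspace S \<and> closed S \<and> e ` I \<subseteq> S \<longrightarrow> S = UNIV)"


section \<open>Operators\<close>

definition bounded_op :: "('h::chilbert_space \<Rightarrow> 'h) \<Rightarrow> bool" where
  "bounded_op T \<longleftrightarrow> bounded_linear T \<and> clinear_on UNIV T"

definition adjoint_pair :: "('h::chilbert_space \<Rightarrow> 'h) \<Rightarrow> ('h \<Rightarrow> 'h) \<Rightarrow> bool" where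
  "adjoint_pair T T' \<longleftrightarrow> (\<forall>x y. cinner (T x) y = cinner x (T' y))"

definition compact_op :: "('h::chilbert_space \<Rightarrow> 'h) \<Rightarrow> bool" where
  "compact_op T \<longleftrightarrow> bounded_op T \<and> compact (closure (T ` cball 0 1))"

definition commutator :: "('h::chilbert_space \<Rightarrow> 'h) \<Rightarrow> ('h \<Rightarrow> 'h) \<Rightarrow> 'h \<Rightarrow> 'h" where
  "commutator S T = (\<lambda>x. S (T x) - T (S x))"

definition commutant :: "('h::chilbert_space \<Rightarrow> 'h) set \<Rightarrow> ('h \<Rightarrow> 'h) set" where
  "commutant M = {T. bounded_op T \<and> (\<forall>A\<in>M. A \<circ> T = T \<circ> A)}"

text \<open>An unbounded operator is given by its domain and a function whose values outside the domain
  are irrelevant. The last conjunct says that the adjoint has no larger domain.\<close>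

definition self_adjoint_on :: "'h::chilbert_space set \<Rightarrow> ('h \<Rightarrow> 'h) \<Rightarrow> bool" where
  "self_adjoint_on X D \<longleftrightarrow>
     csubspace X \<and> closure X = UNIV \<and> clinear_on X D \<and>
     (\<forall>x\<in>X. \<forall>y\<in>X. cinner (D x) y = cinner x (D y)) \<and>
     (\<forall>y z. (\<forall>x\<in>X. cinner (D x) y = cinner x z) \<longrightarrow> y \<in> X \<and> D y = z)"

text \<open>The sign of a self-adjoint operator \<open>D\<close> with domain \<open>X\<close>, i.e. the partial isometry \<open>F\<close> of the
  polar decomposition \<open>D = F |D|\<close>: \<open>F\<close> is a self-adjoint partial isometry with the kernel of \<open>D\<close>,
  commuting with \<open>D\<close>, such that \<open>F D\<close> (which is then \<open>|D|\<close>) is positive. These conditions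
  determine \<open>F\<close>: \<open>D\<close> is reduced by the eigenspaces of \<open>F\<close> for 1, -1 and 0, on which it is
  positive injective, negative injective and zero, respectively.\<close>

definition is_sign_of :: "('h::chilbert_space \<Rightarrow> 'h) \<Rightarrow> 'h set \<Rightarrow> ('h \<Rightarrow> 'h) \<Rightarrow> bool" where
  "is_sign_of F X D \<longleftrightarrow>
     bounded_op F \<and> adjoint_pair F F \<and> (\<forall>x. F (F (F x)) = F x) \<and>
     (\<forall>x. F x = 0 \<longleftrightarrow> x \<in> X \<and> D x = 0) \<and>
     (\<forall>x\<in>X. F x \<in> X \<and> D (F x) = F (D x) \<and> cinner x (F (D x)) \<in> \<real>\<^sub>\<ge>\<^sub>0)"

definition star_representation :: "('a::cstar_algebra \<Rightarrow> 'h::chilbert_space \<Rightarrow> 'h) \<Rightarrow> bool" where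
  "star_representation \<rho> \<longleftrightarrow>
     (\<forall>x. bounded_op (\<rho> x)) \<and> \<rho> 1 = id \<and>
     (\<forall>x y v. \<rho> (x + y) v = \<rho> x v + \<rho> y v) \<and>
     (\<forall>c x v. \<rho> (c *\<^sub>C x) v = c *\<^sub>C \<rho> x v) \<and>
     (\<forall>x y. \<rho> (x * y) = \<rho> x \<circ> \<rho> y) \<and>
     (\<forall>x. adjoint_pair (\<rho> x) (\<rho> (star x)))"


section \<open>The C*-algebra of \<open>SU\<^sub>q(2)\<close>\<close>

definition SUq2_relations :: "real \<Rightarrow> 'a::cstar_algebra \<Rightarrow> 'a \<Rightarrow> bool" where
  "SUq2_relations q \<alpha> \<beta> \<longleftrightarrow>
     star \<alpha> * \<alpha> + star \<beta> * \<beta> = 1 \<and>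
     \<alpha> * star \<alpha> + q\<^sup>2 *\<^sub>R (\<beta> * star \<beta>) = 1 \<and>
     \<alpha> * \<beta> = q *\<^sub>R (\<beta> * \<alpha>) \<and>
     \<alpha> * star \<beta> = q *\<^sub>R (star \<beta> * \<alpha>) \<and>
     star \<beta> * \<beta> = \<beta> * star \<beta>"

text \<open>The same relations for bounded operators; \<open>a'\<close> and \<open>b'\<close> are the adjoints of \<open>a\<close> and \<open>b\<close>.\<close>

definition SUq2_operator_relations ::
    "real \<Rightarrow> ('h::chilbert_space \<Rightarrow> 'h) \<Rightarrow> ('h \<Rightarrow> 'h) \<Rightarrow> ('h \<Rightarrow> 'h) \<Rightarrow> ('h \<Rightarrow> 'h) \<Rightarrow> bool" where
  "SUq2_operator_relations q a a' b b' \<longleftrightarrow>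
     bounded_op a \<and> bounded_op a' \<and> bounded_op b \<and> bounded_op b' \<and>
     adjoint_pair a a' \<and> adjoint_pair b b' \<and>
     (\<forall>v. a' (a v) + b' (b v) = v) \<and>
     (\<forall>v. a (a' v) + q\<^sup>2 *\<^sub>R b (b' v) = v) \<and>
     (\<forall>v. a (b v) = q *\<^sub>R b (a v)) \<and>
     (\<forall>v. a (b' v) = q *\<^sub>R b' (a v)) \<and>
     (\<forall>v. b' (b v) = b (b' v))"

text \<open>\<open>'a\<close> is the universal C*-algebra generated by \<open>\<alpha>\<close> and \<open>\<beta>\<close> subject to the relations. The
  universal property is expressed through operators on a Hilbert space \<open>'h\<close>. A C*-algebra with two
  generators is separable and hence embeds into the bounded operators on any infinite-dimensional
  Hilbert space, so for infinite-dimensional \<open>'h\<close> this is the universal property with respect to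
  all unital C*-algebras. Uniqueness of \<open>\<rho>\<close> follows from \<open>\<alpha>\<close> and \<open>\<beta>\<close> being generators.\<close>

definition universal_SUq2 :: "'h::chilbert_space itself \<Rightarrow> real \<Rightarrow> 'a::cstar_algebra \<Rightarrow> 'a \<Rightarrow> bool" where
  "universal_SUq2 _ q \<alpha> \<beta> \<longleftrightarrow>
     SUq2_relations q \<alpha> \<beta> \<and>
     (\<forall>S. csubspace S \<and> closed S \<and> 1 \<in> S \<and> \<alpha> \<in> S \<and> \<beta> \<in> S \<and>
          (\<forall>x\<in>S. \<forall>y\<in>S. x * y \<in> S) \<and> (\<forall>x\<in>S. star x \<in> S) \<longrightarrow> S = UNIV) \<and>
     (\<forall>(a :: 'h \<Rightarrow> 'h) a' b b'. SUq2_operator_relations q a a' b b' \<longrightarrow>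
          (\<exists>\<rho>. star_representation \<rho> \<and> \<rho> \<alpha> = a \<and> \<rho> \<beta> = b))"


section \<open>Comultiplication and Haar state\<close>

datatype letter = Alpha | Alpha_star | Beta | Beta_star

fun letter_val :: "'a::cstar_algebra \<Rightarrow> 'a \<Rightarrow> letter \<Rightarrow> 'a" where
  "letter_val \<alpha> \<beta> Alpha = \<alpha>"
| "letter_val \<alpha> \<beta> Alpha_star = star \<alpha>"
| "letter_val \<alpha> \<beta> Beta = \<beta>"
| "letter_val \<alpha> \<beta> Beta_star = star \<beta>"

definition word_val :: "'a::cstar_algebra \<Rightarrow> 'a \<Rightarrow> letter list \<Rightarrow> 'a" where
  "word_val \<alpha> \<beta> w = prod_list (map (letter_val \<alpha> \<beta>) w)"

text \<open>The comultiplication is the unital *-homomorphism with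
  \<open>\<Delta>(\<alpha>) = \<alpha> \<otimes> \<alpha> - q \<beta>\<^sup>* \<otimes> \<beta>\<close> and \<open>\<Delta>(\<beta>) = \<beta> \<otimes> \<alpha> + \<alpha>\<^sup>* \<otimes> \<beta>\<close>, i.e. the one for which the matrix with
  rows \<open>(\<alpha>, -q \<beta>\<^sup>*)\<close> and \<open>(\<beta>, \<alpha>\<^sup>*)\<close> is a corepresentation. Words in the generators and their adjoints
  are mapped into the algebraic tensor square, whose elements are written here as lists of
  elementary tensors (a list standing for the sum of its entries).\<close>

fun letter_comult :: "real \<Rightarrow> 'a::cstar_algebra \<Rightarrow> 'a \<Rightarrow> letter \<Rightarrow> ('a \<times> 'a) list" where
  "letter_comult q \<alpha> \<beta> Alpha = [(\<alpha>, \<alpha>), (- (q *\<^sub>R star \<beta>), \<beta>)]"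
| "letter_comult q \<alpha> \<beta> Alpha_star = [(star \<alpha>, star \<alpha>), (- (q *\<^sub>R \<beta>), star \<beta>)]"
| "letter_comult q \<alpha> \<beta> Beta = [(\<beta>, \<alpha>), (star \<alpha>, \<beta>)]"
| "letter_comult q \<alpha> \<beta> Beta_star = [(star \<beta>, star \<alpha>), (\<alpha>, star \<beta>)]"

fun word_comult :: "real \<Rightarrow> 'a::cstar_algebra \<Rightarrow> 'a \<Rightarrow> letter list \<Rightarrow> ('a \<times> 'a) list" where
  "word_comult q \<alpha> \<beta> [] = [(1, 1)]"
| "word_comult q \<alpha> \<beta> (l # w) =
     [(x * x', y * y'). (x, y) \<leftarrow> letter_comult q \<alpha> \<beta> l, (x', y') \<leftarrow> word_comult q \<alpha> \<beta> w]"

definition cstar_state :: "('a::cstar_algebra \<Rightarrow> complex) \<Rightarrow> bool" where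
  "cstar_state h \<longleftrightarrow>
     (\<forall>x y. h (x + y) = h x + h y) \<and> (\<forall>c x. h (c *\<^sub>C x) = c * h x) \<and>
     (\<forall>x. h (star x * x) \<in> \<real>\<^sub>\<ge>\<^sub>0) \<and> h 1 = 1"

text \<open>Invariance \<open>(h \<otimes> id) \<Delta>(x) = h(x) 1 = (id \<otimes> h) \<Delta>(x)\<close>. It suffices to require this for the words
  \<open>x\<close>, since these span a dense subspace and all the maps involved are continuous.\<close>

definition haar_state :: "real \<Rightarrow> 'a::cstar_algebra \<Rightarrow> 'a \<Rightarrow> ('a \<Rightarrow> complex) \<Rightarrow> bool" where
  "haar_state q \<alpha> \<beta> h \<longleftrightarrow> cstar_state h \<and>
     (\<forall>w. (\<Sum>(x, y)\<leftarrow>word_comult q \<alpha> \<beta> w. h x *\<^sub>C y) = h (word_val \<alpha> \<beta> w) *\<^sub>C 1 \<and>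
          (\<Sum>(x, y)\<leftarrow>word_comult q \<alpha> \<beta> w. h y *\<^sub>C x) = h (word_val \<alpha> \<beta> w) *\<^sub>C 1)"

text \<open>\<open>'h\<close> is the GNS space of \<open>h\<close>, with \<open>\<Lambda> x\<close> the class of \<open>x\<close> and \<open>\<pi>\<close> the representation by left
  multiplication.\<close>

definition gns_representation ::
    "('a::cstar_algebra \<Rightarrow> complex) \<Rightarrow> ('a \<Rightarrow> 'h::chilbert_space \<Rightarrow> 'h) \<Rightarrow> ('a \<Rightarrow> 'h) \<Rightarrow> bool" where
  "gns_representation h \<pi> \<Lambda> \<longleftrightarrow>
     star_representation \<pi> \<and>
     clinear_on UNIV \<Lambda> \<and> closure (range \<Lambda>) = UNIV \<and>
     (\<forall>x y. cinner (\<Lambda> x) (\<Lambda> y) = h (star x * y)) \<and>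
     (\<forall>x y. \<pi> x (\<Lambda> y) = \<Lambda> (x * y))"


section \<open>The canonical basis and the equivariant Dirac operator\<close>

text \<open>The triples \<open>(n, i, j)\<close> with \<open>n \<in> {0, 1/2, 1, \<dots>}\<close> and \<open>i, j \<in> {-n, -n+1, \<dots>, n}\<close>.\<close>

definition spin_index :: "(real \<times> real \<times> real) set" where
  "spin_index = {(n, i, j). \<exists>N k l :: nat. k \<le> N \<and> l \<le> N \<and>
     n = real N / 2 \<and> i = - n + real k \<and> j = - n + real l}"

definition a_plus :: "real \<Rightarrow> real \<Rightarrow> real \<Rightarrow> real \<Rightarrow> real" where
  "a_plus q n i j = sqrt (q powr (2*(n+i) + 2*(n+j) + 2) *
     ((1 - q powr (2*n - 2*j + 2)) * (1 - q powr (2*n - 2*i + 2)) /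
      ((1 - q powr (4*n + 2)) * (1 - q powr (4*n + 4)))))"

definition a_minus :: "real \<Rightarrow> real \<Rightarrow> real \<Rightarrow> real \<Rightarrow> real" where
  "a_minus q n i j = sqrt ((1 - q powr (2*n + 2*j)) * (1 - q powr (2*n + 2*i)) /
      ((1 - q powr (4*n)) * (1 - q powr (4*n + 2))))"

definition b_plus :: "real \<Rightarrow> real \<Rightarrow> real \<Rightarrow> real \<Rightarrow> real" where
  "b_plus q n i j = - sqrt (q powr (2*(n+j)) *
     ((1 - q powr (2*n - 2*j + 2)) * (1 - q powr (2*n + 2*i + 2)) /
      ((1 - q powr (4*n + 2)) * (1 - q powr (4*n + 4)))))"

definition b_minus :: "real \<Rightarrow> real \<Rightarrow> real \<Rightarrow> real \<Rightarrow> real" where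
  "b_minus q n i j = sqrt (q powr (2*(n+i)) *
     ((1 - q powr (2*n + 2*j)) * (1 - q powr (2*n - 2*i)) /
      ((1 - q powr (4*n)) * (1 - q powr (4*n + 2)))))"

text \<open>Basis vectors that do not exist are read as zero.\<close>

definition basis_vec :: "(real \<times> real \<times> real \<Rightarrow> 'h::chilbert_space) \<Rightarrow> real \<Rightarrow> real \<Rightarrow> real \<Rightarrow> 'h" where
  "basis_vec e n i j = (if (n, i, j) \<in> spin_index then e (n, i, j) else 0)"

text \<open>The orthonormal basis of normalized matrix entries, specified by its initial vector (the class
  of 1) and the action of the generators. These data determine it uniquely: applying \<open>\<pi> \<alpha>\<close>, \<open>\<pi> \<beta>\<close>
  and their adjoints to the basis vectors for \<open>n\<close> yields those for \<open>n + 1/2\<close>.\<close>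

definition canonical_basis ::
    "real \<Rightarrow> 'a::cstar_algebra \<Rightarrow> 'a \<Rightarrow> ('a \<Rightarrow> 'h::chilbert_space \<Rightarrow> 'h) \<Rightarrow> ('a \<Rightarrow> 'h) \<Rightarrow>
     (real \<times> real \<times> real \<Rightarrow> 'h) \<Rightarrow> bool" where
  "canonical_basis q \<alpha> \<beta> \<pi> \<Lambda> e \<longleftrightarrow>
     orthonormal_basis_on spin_index e \<and>
     e (0, 0, 0) = \<Lambda> 1 \<and>
     (\<forall>(n, i, j) \<in> spin_index.
        \<pi> \<alpha> (e (n, i, j)) = a_plus q n i j *\<^sub>R basis_vec e (n + 1/2) (i - 1/2) (j - 1/2) +
                          a_minus q n i j *\<^sub>R basis_vec e (n - 1/2) (i - 1/2) (j - 1/2) \<and>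
        \<pi> \<beta> (e (n, i, j)) = b_plus q n i j *\<^sub>R basis_vec e (n + 1/2) (i + 1/2) (j - 1/2) +
                          b_minus q n i j *\<^sub>R basis_vec e (n - 1/2) (i + 1/2) (j - 1/2))"

definition dirac_eigenvalue :: "real \<Rightarrow> real \<Rightarrow> real" where
  "dirac_eigenvalue n i = (if i \<noteq> n then 2*n + 1 else - (2*n + 1))"

text \<open>The self-adjoint operator diagonal in the basis \<open>e\<close> is unique: it contains the closure of its
  restriction to the linear span of \<open>e\<close>, and that restriction is essentially self-adjoint.\<close>

definition equivariant_dirac ::
    "(real \<times> real \<times> real \<Rightarrow> 'h::chilbert_space) \<Rightarrow> 'h set \<Rightarrow> ('h \<Rightarrow> 'h) \<Rightarrow> bool" where
  "equivariant_dirac e X D \<longleftrightarrow> self_adjoint_on X D \<and>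
     (\<forall>(n, i, j) \<in> spin_index.
        e (n, i, j) \<in> X \<and> D (e (n, i, j)) = dirac_eigenvalue n i *\<^sub>R e (n, i, j))"

end

theory Submission
  imports Defs
begin

text \<open>Write \<open>a\<close>, \<open>b\<close> for the actions of \<open>\<alpha>\<close>, \<open>\<beta>\<close>, and \<open>a'\<close>, \<open>b'\<close> for their adjoints, \<open>e\<^sub>0\<close> for the cyclic
  vector \<open>e(0, 0, 0)\<close>, \<open>T'\<close> for the adjoint of \<open>T\<close>, and \<open>H i j\<close> for the weight space spanned by all
  \<open>e(n, i, j)\<close>. Since \<open>e\<^sub>0\<close> is cyclic, it suffices to show that \<open>T e\<^sub>0\<close> is a multiple of \<open>e\<^sub>0\<close>. The
  generators and \<open>F\<close> are homogeneous for the decomposition into weight spaces, so \<open>T e\<^sub>0\<close> can be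
  analysed one weight at a time.

  The vectors \<open>a'\<^sup>N e\<^sub>0\<close> and \<open>b\<^sup>N e\<^sub>0\<close> are multiples of \<open>e(N/2, N/2, N/2)\<close> and \<open>e(N/2, N/2, -N/2)\<close>. They are
  fixed by \<open>-F\<close> and weakly null, so compactness of the commutator gives
  \<open>(F + 1) a'\<^sup>N T e\<^sub>0 \<longlonglongrightarrow> 0\<close> and \<open>(F + 1) b\<^sup>N T e\<^sub>0 \<longlonglongrightarrow> 0\<close>, and the same for \<open>T'\<close>
  (\<open>a'_pow_defect\<close>, \<open>b_pow_defect\<close>). On \<open>H i j\<close> the kernel of \<open>F + 1\<close> is spanned by \<open>e(i, i, j)\<close>, if this
  exists, and is zero otherwise. In addition \<open>a'\<^sup>N v \<longlonglongrightarrow> 0\<close> implies \<open>v = 0\<close>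
  (\<open>a'_pow_tendsto_0_imp\<close>): the loss of norm \<open>\<parallel>a'\<^sup>N v\<parallel>\<^sup>2 - \<parallel>a'\<^sup>N\<^sup>+\<^sup>1 v\<parallel>\<^sup>2 = q\<^sup>2 \<parallel>b' a'\<^sup>N v\<parallel>\<^sup>2\<close> decays geometrically. This
  yields two facts about the components of \<open>T e\<^sub>0\<close>: those in \<open>H i j\<close> with \<open>i < j\<close> vanish
  (\<open>defect_imp_orthogonal\<close>), and the one in \<open>H (M/2) (M/2)\<close> is a multiple \<open>\<mu> a'\<^sup>M e\<^sub>0\<close>
  (\<open>defect_imp_multiple\<close>).

  For \<open>M > 0\<close> this multiple is zero. Its coefficient \<open>\<nu>\<close> for \<open>T'\<close> appears when \<open>b\<^sup>N T e\<^sub>0\<close> is paired with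
  \<open>b\<^sup>N a\<^sup>M e\<^sub>0\<close>: the latter is fixed by \<open>F\<close>, so the pairing tends to zero, but it equals
  \<open>\<parallel>a'\<^sup>M b\<^sup>N e\<^sub>0\<parallel>\<^sup>2\<close> times the conjugate of \<open>\<nu>\<close>, and this norm is bounded below
  (\<open>adjoint_coefficient_0\<close>); the roles of \<open>T\<close> and \<open>T'\<close> may be exchanged. Finally \<open>e(n, i, j) = X e\<^sub>0\<close> for a
  homogeneous polynomial \<open>X\<close> in the generators, and
  \<open>\<langle>X e\<^sub>0, T e\<^sub>0\<rangle> = \<langle>T' e\<^sub>0, X\<^sup>* e\<^sub>0\<rangle>\<close>. So the component of \<open>T e\<^sub>0\<close> in \<open>H i j\<close> vanishes as soon as that of
  \<open>T' e\<^sub>0\<close> in \<open>H (-i) (-j)\<close> does (\<open>cinner_e_commuting_dual\<close>). Only the component in \<open>H 0 0\<close> survives, and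
  it is a multiple of \<open>e\<^sub>0\<close>.\<close>

section \<open>Complex Hilbert space preliminaries\<close>

lemma scaleC_zero_right [simp]: "c *\<^sub>C (0::'a::complex_vector) = 0"
  using scaleC_add_right[of c "0::'a" 0] by simp

lemma scaleC_zero_left [simp]: "0 *\<^sub>C (x::'a::complex_vector) = 0"
  using scaleC_add_left[of 0 0 x] by simp

lemma scaleC_minus_left: "(- c) *\<^sub>C (x::'a::complex_vector) = - (c *\<^sub>C x)"
  using scaleC_add_left[of c "- c" x] by (simp add: eq_neg_iff_add_eq_0 add.commute)

lemma scaleC_minus_right: "c *\<^sub>C (- x::'a::complex_vector) = - (c *\<^sub>C x)"
  using scaleC_add_right[of c x "- x"] by (simp add: eq_neg_iff_add_eq_0 add.commute)

lemma scaleC_diff_right: "c *\<^sub>C (x - y::'a::complex_vector) = c *\<^sub>C x - c *\<^sub>C y"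
  using scaleC_add_right[of c x "- y"] by (simp add: scaleC_minus_right)

lemma scaleC_diff_left: "(c - d) *\<^sub>C (x::'a::complex_vector) = c *\<^sub>C x - d *\<^sub>C x"
  using scaleC_add_left[of c "- d" x] by (simp add: scaleC_minus_left)

lemma cinner_add_left: "cinner (x + y) z = cinner x z + cinner (y::'h::chilbert_space) z"
  by (metis cinner_add_right cinner_commute complex_cnj_add)

lemma cinner_scaleC_left: "cinner (c *\<^sub>C x) y = cnj c * cinner (x::'h::chilbert_space) y"
  by (metis cinner_commute cinner_scaleC_right complex_cnj_mult)

lemma cinner_scaleR_right: "cinner x (r *\<^sub>R y) = of_real r * cinner (x::'h::chilbert_space) y"
  by (metis cinner_scaleC_right scaleC_of_real)

lemma cinner_scaleR_left: "cinner (r *\<^sub>R x) y = of_real r * cinner (x::'h::chilbert_space) y"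
  by (metis cinner_scaleC_left complex_cnj_complex_of_real scaleC_of_real)

lemma cinner_zero_right [simp]: "cinner x (0::'h::chilbert_space) = 0"
  using cinner_scaleR_right[of x 0 x] by simp

lemma cinner_zero_left [simp]: "cinner (0::'h::chilbert_space) x = 0"
  using cinner_scaleR_left[of 0 x x] by simp

lemma cinner_minus_right: "cinner x (- y) = - cinner (x::'h::chilbert_space) y"
  using cinner_scaleR_right[of x "-1" y] by simp

lemma cinner_minus_left: "cinner (- x) y = - cinner (x::'h::chilbert_space) y"
  using cinner_scaleR_left[of "-1" x y] by simp

lemma cinner_diff_right: "cinner x (y - z) = cinner x y - cinner (x::'h::chilbert_space) z"
  using cinner_add_right[of x y "- z"] by (simp add: cinner_minus_right)

lemma cinner_diff_left: "cinner (x - y) z = cinner x z - cinner (y::'h::chilbert_space) z"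
  using cinner_add_left[of x "- y" z] by (simp add: cinner_minus_left)

lemma cinner_eq_inner:
  "cinner x (y::'h::chilbert_space) =
     complex_of_real (inner x y) + \<i> * complex_of_real (inner x ((- \<i>) *\<^sub>C y))"
  by (simp add: complex_eq_iff inner_eq_Re_cinner cinner_scaleC_right)

lemma cinner_self: "cinner (x::'h::chilbert_space) x = complex_of_real ((norm x)\<^sup>2)"
proof -
  have "Im (cinner x x) = 0"
    using arg_cong[OF cinner_commute[of x x], of Im] by simp
  then show ?thesis
    by (simp add: complex_eq_iff power2_norm_eq_inner inner_eq_Re_cinner)
qed

lemma norm_scaleC_chilbert: "norm (c *\<^sub>C (x::'h::chilbert_space)) = cmod c * norm x"
proof -
  have "complex_of_real ((norm (c *\<^sub>C x))\<^sup>2) = (c * cnj c) * cinner x x"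
    by (simp only: cinner_self[symmetric] cinner_scaleC_left cinner_scaleC_right mult_ac)
  also have "\<dots> = complex_of_real ((cmod c * norm x)\<^sup>2)"
    by (simp add: cinner_self power_mult_distrib flip: complex_norm_square)
  finally have "complex_of_real ((norm (c *\<^sub>C x))\<^sup>2) = complex_of_real ((cmod c * norm x)\<^sup>2)" .
  then have "(norm (c *\<^sub>C x))\<^sup>2 = (cmod c * norm x)\<^sup>2"
    by (simp only: of_real_eq_iff)
  then show ?thesis by simp
qed

lemma norm_cinner_le: "cmod (cinner x (y::'h::chilbert_space)) \<le> norm x * norm y"
proof (cases "cinner x y = 0")
  case False
  let ?c = "cinner x y"
  have "cnj ?c * ?c = complex_of_real ((cmod ?c)\<^sup>2)"
    by (metis complex_norm_square mult.commute)
  then have "(cmod ?c)\<^sup>2 = inner (?c *\<^sub>C x) y"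
    by (simp add: inner_eq_Re_cinner cinner_scaleC_left)
  also have "\<dots> \<le> norm (?c *\<^sub>C x) * norm y" by (rule norm_cauchy_schwarz)
  finally have "cmod ?c * cmod ?c \<le> cmod ?c * (norm x * norm y)"
    by (simp add: norm_scaleC_chilbert power2_eq_square mult.assoc)
  then show ?thesis using False by simp
qed simp

lemma cinner_eqI:
  assumes "\<And>x. cinner x u = cinner x (v::'h::chilbert_space)"
  shows "u = v"
proof -
  have "cinner (u - v) (u - v) = 0" by (simp add: cinner_diff_right assms)
  then show ?thesis by (simp add: cinner_self)
qed

lemma adjoint_pair_sym: "adjoint_pair S S' \<Longrightarrow> adjoint_pair S' S"
  unfolding adjoint_pair_def by (metis cinner_commute)

lemma adjoint_pair_comp:
  "adjoint_pair S S' \<Longrightarrow> adjoint_pair R R' \<Longrightarrow> adjoint_pair (\<lambda>x. S (R x)) (\<lambda>x. R' (S' x))"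
  by (simp add: adjoint_pair_def)

lemma adjoint_pair_funpow: "adjoint_pair S S' \<Longrightarrow> adjoint_pair (S ^^ n) (S' ^^ n)"
proof (induction n)
  case (Suc n)
  from adjoint_pair_comp[OF Suc.prems Suc.IH[OF Suc.prems]] show ?case
    unfolding funpow.simps(2)[of n S] funpow_Suc_right[of n S'] by (simp add: o_def)
qed (simp add: adjoint_pair_def)

lemma adjoint_pair_inner: "adjoint_pair S S' \<Longrightarrow> inner (S x) y = inner x (S' y)"
  by (simp add: adjoint_pair_def inner_eq_Re_cinner)

lemma
  assumes "bounded_op S"
  shows bounded_op_add: "S (x + y) = S x + S y"
    and bounded_op_diff: "S (x - y) = S x - S y"
    and bounded_op_scaleR: "S (r *\<^sub>R x) = r *\<^sub>R S x"
    and bounded_op_scaleC: "S (c *\<^sub>C x) = c *\<^sub>C S x"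
    and bounded_op_zero: "S 0 = 0"
proof -
  from assms interpret bounded_linear S by (simp add: bounded_op_def)
  show "S (x + y) = S x + S y" "S (x - y) = S x - S y" "S (r *\<^sub>R x) = r *\<^sub>R S x" "S 0 = 0"
    by (rule add diff scaleR zero)+
  show "S (c *\<^sub>C x) = c *\<^sub>C S x"
    using assms by (simp add: bounded_op_def clinear_on_def)
qed

lemma bounded_op_funpow:
  assumes "bounded_op S"
  shows "bounded_op (S ^^ n)"
proof (induction n)
  case 0
  then show ?case by (simp add: bounded_op_def clinear_on_def bounded_linear_ident id_def)
next
  case (Suc n)
  then show ?case using assms
    by (auto simp: bounded_op_def clinear_on_def o_def bounded_linear_compose)
qed

lemma bounded_op_compose: "bounded_op S \<Longrightarrow> bounded_op R \<Longrightarrow> bounded_op (\<lambda>x. S (R x))"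
  by (auto simp: bounded_op_def clinear_on_def bounded_linear_compose)

lemma bounded_op_sub: "bounded_op S \<Longrightarrow> bounded_op R \<Longrightarrow> bounded_op (\<lambda>x. S x - R x)"
  by (auto simp: bounded_op_def clinear_on_def bounded_linear_sub scaleC_diff_right)

lemma tendsto_cinner:
  fixes f g :: "_ \<Rightarrow> 'h::chilbert_space"
  assumes "(f \<longlongrightarrow> x) A" "(g \<longlongrightarrow> y) A"
  shows "((\<lambda>n. cinner (f n) (g n)) \<longlongrightarrow> cinner x y) A"
proof -
  have "((\<lambda>n. (- \<i>) *\<^sub>C g n) \<longlongrightarrow> (- \<i>) *\<^sub>C y) A"
  proof (rule tendstoI)
    fix r :: real assume "0 < r"
    show "\<forall>\<^sub>F n in A. dist ((- \<i>) *\<^sub>C g n) ((- \<i>) *\<^sub>C y) < r"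
      using tendstoD[OF assms(2) \<open>0 < r\<close>]
      by (simp add: dist_norm norm_scaleC_chilbert flip: scaleC_diff_right)
  qed
  then show ?thesis
    using assms unfolding cinner_eq_inner
    by (intro tendsto_intros)
qed

lemma closed_cinner_kernel: "closed {x::'h::chilbert_space. cinner x y = 0}"
proof -
  have "continuous_on UNIV (\<lambda>x. cinner x y)"
    unfolding continuous_on_def by (auto intro: tendsto_cinner)
  then show ?thesis
    using continuous_closed_preimage_constant[of UNIV "\<lambda>x. cinner x y" 0] by simp
qed

lemma closed_cinner_kernel': "closed {x::'h::chilbert_space. cinner y x = 0}"
proof -
  have "{x. cinner y x = 0} = {x::'h. cinner x y = 0}"
    by (metis cinner_commute complex_cnj_zero_iff)
  then show ?thesis by (simp add: closed_cinner_kernel)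
qed

subsection \<open>Orthogonal projection and adjoints\<close>

text \<open>The orthogonal projection onto a closed subspace: \<open>s\<close> is the point of \<open>S\<close> nearest to \<open>x\<close>.\<close>

lemma orthogonal_decomposition_real:
  fixes S :: "'a::{real_inner, complete_space} set"
  assumes S: "subspace S" "closed S"
  obtains s where "s \<in> S" "\<And>y. y \<in> S \<Longrightarrow> inner (x - s) y = 0"
proof -
  define d where "d = Inf ((\<lambda>y. (norm (x - y))\<^sup>2) ` S)"
  have ne: "S \<noteq> {}" using subspace_0[OF S(1)] by blast
  have bdd: "bdd_below ((\<lambda>y. (norm (x - y))\<^sup>2) ` S)"
    by (rule bdd_belowI[of _ 0]) auto
  have d_le: "d \<le> (norm (x - y))\<^sup>2" if "y \<in> S" for y
    unfolding d_def using bdd that by (auto intro: cInf_lower)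
  have "\<exists>y\<in>S. (norm (x - y))\<^sup>2 < d + 1 / real (Suc n)" for n
  proof -
    have "Inf ((\<lambda>y. (norm (x - y))\<^sup>2) ` S) < d + 1 / real (Suc n)"
      by (simp add: d_def)
    from cInf_lessD[OF _ this] ne show ?thesis by auto
  qed
  then obtain f where fS: "\<And>n. f n \<in> S" and f: "\<And>n. (norm (x - f n))\<^sup>2 < d + 1 / real (Suc n)"
    by metis
  \<comment> \<open>The parallelogram law shows that a minimizing sequence is Cauchy.\<close>
  have par: "(norm (f m - f n))\<^sup>2 \<le> 2 / real (Suc m) + 2 / real (Suc n)" for m n
  proof -
    have "(1/2) *\<^sub>R (f m + f n) \<in> S"
      using fS S(1) by (simp add: subspace_add subspace_scale)
    from d_le[OF this] have "4 * d \<le> 4 * (norm (x - (1/2) *\<^sub>R (f m + f n)))\<^sup>2" by simp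
    also have "\<dots> = (norm (2 *\<^sub>R (x - (1/2) *\<^sub>R (f m + f n))))\<^sup>2"
      by (simp add: power_mult_distrib)
    also have "2 *\<^sub>R (x - (1/2) *\<^sub>R (f m + f n)) = (x - f m) + (x - f n)"
      by (simp add: algebra_simps scaleR_2)
    finally have 1: "4 * d \<le> (norm ((x - f m) + (x - f n)))\<^sup>2" .
    have 2: "(norm ((x - f m) + (x - f n)))\<^sup>2 + (norm (f m - f n))\<^sup>2 =
        2 * (norm (x - f m))\<^sup>2 + 2 * (norm (x - f n))\<^sup>2"
      by (simp add: power2_norm_eq_inner inner_diff_left inner_diff_right inner_add_left
          inner_add_right inner_commute)
    show ?thesis using 1 2 f[of m] f[of n] by simp
  qed
  have "Cauchy f"
    unfolding Cauchy_def
  proof (intro allI impI)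
    fix r :: real assume "0 < r"
    then have "0 < r\<^sup>2 / 4" by simp
    then obtain M where M: "inverse (real (Suc M)) < r\<^sup>2 / 4"
      using reals_Archimedean by blast
    have "dist (f m) (f n) < r" if "m \<ge> M" "n \<ge> M" for m n
    proof -
      have "1 / real (Suc m) \<le> 1 / real (Suc M)" "1 / real (Suc n) \<le> 1 / real (Suc M)"
        using that by (simp_all add: frac_le)
      then have "(norm (f m - f n))\<^sup>2 < r\<^sup>2"
        using par[of m n] M by (simp add: inverse_eq_divide)
      then show ?thesis using \<open>0 < r\<close>
        by (simp add: dist_norm power_less_imp_less_base)
    qed
    then show "\<exists>M. \<forall>m\<ge>M. \<forall>n\<ge>M. dist (f m) (f n) < r" by blast
  qed
  then obtain s where s: "f \<longlonglongrightarrow> s" using Cauchy_convergent convergent_def by blast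
  have sS: "s \<in> S" using closed_sequentially[OF S(2)] fS s by blast
  have "(\<lambda>n. d + 1 / real (Suc n)) \<longlonglongrightarrow> d + 0"
    by (intro tendsto_intros LIMSEQ_Suc[OF lim_1_over_n])
  then have min: "(norm (x - s))\<^sup>2 \<le> d"
    by (intro LIMSEQ_le[OF tendsto_power[OF tendsto_norm[OF tendsto_diff[OF tendsto_const s]]]])
      (use f in \<open>auto intro!: exI[of _ 0] less_imp_le simp del: of_nat_Suc\<close>)
  have "inner (x - s) y = 0" if y: "y \<in> S" for y
  proof (cases "y = 0")
    case False
    \<comment> \<open>The value of \<open>t\<close> that minimizes \<open>\<parallel>x - s - t y\<parallel>\<close>; comparison with \<open>t = 0\<close> gives the claim.\<close>
    define t where "t = inner (x - s) y / (norm y)\<^sup>2"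
    have "s + t *\<^sub>R y \<in> S" using sS y S(1) by (simp add: subspace_add subspace_scale)
    from order.trans[OF min d_le[OF this]]
    have "(norm (x - s))\<^sup>2 \<le> (norm ((x - s) - t *\<^sub>R y))\<^sup>2" by (simp add: algebra_simps)
    also have "\<dots> = (norm (x - s))\<^sup>2 - 2 * t * inner (x - s) y + t\<^sup>2 * (norm y)\<^sup>2"
      using dot_norm_neg[of "x - s" "t *\<^sub>R y"] by (simp add: power_mult_distrib field_simps)
    also have "t\<^sup>2 * (norm y)\<^sup>2 = t * inner (x - s) y"
      using False by (simp add: t_def power2_eq_square)
    finally have "t * inner (x - s) y \<le> 0" by simp
    then have "(inner (x - s) y)\<^sup>2 / (norm y)\<^sup>2 \<le> 0" by (simp add: t_def power2_eq_square)
    then show ?thesis using False by (simp add: divide_le_0_iff)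
  qed simp
  with sS show ?thesis by (rule that)
qed

lemma csubspace_imp_subspace: "csubspace S \<Longrightarrow> subspace S"
  unfolding csubspace_def subspace_def by (metis scaleC_of_real)

lemma orthogonal_decomposition:
  fixes S :: "'h::chilbert_space set"
  assumes S: "csubspace S" "closed S"
  obtains s where "s \<in> S" "\<And>y. y \<in> S \<Longrightarrow> cinner y (x - s) = 0"
proof -
  obtain s where s: "s \<in> S" "\<And>y. y \<in> S \<Longrightarrow> inner (x - s) y = 0"
    by (rule orthogonal_decomposition_real[OF csubspace_imp_subspace[OF S(1)] S(2), where x = x],
        rule that, blast, blast)
  have "cinner y (x - s) = 0" if "y \<in> S" for y
  proof -
    have "(- \<i>) *\<^sub>C y \<in> S" using S(1) that by (simp add: csubspace_def)
    then have "cinner (x - s) y = 0"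
      using s(2) that by (simp add: cinner_eq_inner)
    then show ?thesis by (metis cinner_commute complex_cnj_zero)
  qed
  with s(1) show ?thesis by (rule that)
qed

lemma riesz_representation:
  fixes f :: "'a::{real_inner, complete_space} \<Rightarrow> real"
  assumes "bounded_linear f"
  obtains z where "\<And>x. f x = inner z x"
proof (cases "\<forall>x. f x = 0")
  case True
  then show ?thesis using that[of 0] by simp
next
  case False
  then obtain x where x: "f x \<noteq> 0" by blast
  interpret f: bounded_linear f by fact
  have S: "subspace {y. f y = 0}"
    by (simp add: subspace_def f.add f.scaleR f.zero)
  have cl: "closed {y. f y = 0}"
    using continuous_closed_preimage_constant[of UNIV f 0] f.continuous_on[OF continuous_on_id]
    by simp
  obtain s where "s \<in> {y. f y = 0}" and "\<And>y. y \<in> {y. f y = 0} \<Longrightarrow> inner (x - s) y = 0"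
    by (rule orthogonal_decomposition_real[OF S cl, where x = x], rule that, blast, blast)
  then have s: "f s = 0" "\<And>y. f y = 0 \<Longrightarrow> inner (x - s) y = 0" by simp_all
  define w where "w = x - s"
  have fw: "f w \<noteq> 0" using x s(1) by (simp add: w_def f.diff)
  then have w0: "w \<noteq> 0" using f.zero by auto
  have "f y = inner ((f w / inner w w) *\<^sub>R w) y" for y
  proof -
    have "f (y - (f y / f w) *\<^sub>R w) = 0" using fw by (simp add: f.diff f.scaleR)
    from s(2)[OF this] have "inner w y = (f y / f w) * inner w w"
      by (simp add: w_def inner_diff_right)
    then show ?thesis using fw w0 by simp
  qed
  then show ?thesis by (rule that)
qed

lemma adjoint_exists:
  fixes S :: "'h::chilbert_space \<Rightarrow> 'h"
  assumes S: "bounded_op S"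
  obtains S' where "bounded_op S'" "adjoint_pair S S'"
proof -
  interpret S: bounded_linear S using S by (simp add: bounded_op_def)
  have "\<exists>z. \<forall>x. inner y (S x) = inner z x" for y
  proof -
    have "bounded_linear (\<lambda>x. inner y (S x))"
      by (intro bounded_linear_inner_right_comp S.bounded_linear)
    then show ?thesis using riesz_representation by metis
  qed
  then obtain S' where S': "\<And>x y. inner y (S x) = inner (S' y) x" by metis
  have adj: "adjoint_pair S S'"
    unfolding adjoint_pair_def
  proof (intro allI)
    fix x y
    have "cinner y (S x) = cinner (S' y) x"
      unfolding cinner_eq_inner
      by (simp add: S' flip: bounded_op_scaleC[OF S])
    then show "cinner (S x) y = cinner x (S' y)" by (metis cinner_commute)
  qed
  have lin: "S' (u + v) = S' u + S' v" "S' (c *\<^sub>C u) = c *\<^sub>C S' u" for u v c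
    by (rule cinner_eqI, simp add: cinner_add_right cinner_scaleC_right
        flip: adj[unfolded adjoint_pair_def, rule_format])+
  obtain M where M: "\<And>x. norm (S x) \<le> norm x * M" using S.bounded by blast
  have "norm (S' y) \<le> norm y * \<bar>M\<bar>" for y
  proof (cases "S' y = 0")
    case False
    have "(norm (S' y))\<^sup>2 = inner y (S (S' y))" by (simp add: S' power2_norm_eq_inner)
    also have "\<dots> \<le> norm y * norm (S (S' y))" by (rule norm_cauchy_schwarz)
    also have "\<dots> \<le> norm y * (norm (S' y) * \<bar>M\<bar>)"
      using order.trans[OF M[of "S' y"] mult_left_mono[OF abs_ge_self]]
      by (intro mult_left_mono) auto
    finally have "norm (S' y) * norm (S' y) \<le> norm (S' y) * (norm y * \<bar>M\<bar>)"
      by (simp add: power2_eq_square ac_simps)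
    then show ?thesis using False by simp
  qed simp
  then have "bounded_linear S'"
    by (intro bounded_linear_intro[where K = "\<bar>M\<bar>"])
      (auto simp: lin simp flip: scaleC_of_real)
  then have "bounded_op S'" by (simp add: bounded_op_def clinear_on_def lin)
  from this adj show ?thesis by (rule that)
qed

subsection \<open>Compact operators and weakly null sequences\<close>

text \<open>Weak convergence of a bounded sequence to zero is uniform on compact sets, by total
  boundedness.\<close>

lemma weakly_null_uniform_on_compact:
  fixes x :: "nat \<Rightarrow> 'a::real_inner"
  assumes C: "compact C" and c: "\<And>n. c n \<in> C" and B: "\<And>n. norm (x n) \<le> B"
    and weak: "\<And>y. (\<lambda>n. inner y (x n)) \<longlonglongrightarrow> 0"
  shows "(\<lambda>n. inner (c n) (x n)) \<longlonglongrightarrow> 0"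
proof (rule LIMSEQ_I)
  fix r :: real assume r: "0 < r"
  have B0: "0 \<le> B" using B[of 0] norm_ge_zero order.trans by blast
  define d where "d = r / (2 * (B + 1))"
  have d: "0 < d" using r B0 by (simp add: d_def)
  obtain K where K: "finite K" "C \<subseteq> (\<Union>k\<in>K. ball k d)"
    using C d unfolding compact_eq_totally_bounded by meson
  have "\<forall>\<^sub>F n in sequentially. \<bar>inner k (x n)\<bar> < r / 2" for k
    using tendstoD[OF weak[of k], of "r / 2"] r by (simp add: dist_real_def)
  then have "\<forall>\<^sub>F n in sequentially. \<forall>k\<in>K. \<bar>inner k (x n)\<bar> < r / 2"
    using K(1) by (simp add: eventually_ball_finite)
  then obtain M where M: "\<And>n k. n \<ge> M \<Longrightarrow> k \<in> K \<Longrightarrow> \<bar>inner k (x n)\<bar> < r / 2"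
    by (auto simp: eventually_sequentially)
  have "\<bar>inner (c n) (x n)\<bar> < r" if n: "n \<ge> M" for n
  proof -
    obtain k where k: "k \<in> K" "dist k (c n) < d" using K(2) c[of n] by fastforce
    have "\<bar>inner (c n - k) (x n)\<bar> \<le> norm (c n - k) * norm (x n)"
      by (rule Cauchy_Schwarz_ineq2)
    also have "\<dots> \<le> d * (B + 1)"
      using k(2) B[of n] B0 d by (intro mult_mono) (auto simp: dist_norm norm_minus_commute)
    also have "\<dots> = r / 2" using B0 by (simp add: d_def field_simps)
    finally have "\<bar>inner (c n - k) (x n)\<bar> \<le> r / 2" .
    then show ?thesis using M[OF n k(1)] unfolding inner_diff_left by linarith
  qed
  then show "\<exists>M. \<forall>n\<ge>M. norm (inner (c n) (x n) - 0) < r" by auto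
qed

lemma
  fixes K :: "'h::chilbert_space \<Rightarrow> 'h"
  assumes K: "compact_op K" and adj: "adjoint_pair K K'" and K': "bounded_op K'"
    and B: "\<And>n. norm (x n) \<le> 1"
    and weak: "\<And>y. (\<lambda>n. inner y (x n)) \<longlonglongrightarrow> 0"
  shows compact_op_weakly_null: "(\<lambda>n. K (x n)) \<longlonglongrightarrow> 0"
    and compact_op_adjoint_weakly_null: "(\<lambda>n. K' (x n)) \<longlonglongrightarrow> 0"
proof -
  let ?C = "closure (K ` cball 0 1)"
  have C: "compact ?C" and Kb: "bounded_op K" using K by (auto simp: compact_op_def)
  have in_C: "K y \<in> ?C" if "norm y \<le> 1" for y
    using that closure_subset[of "K ` cball 0 1"] by auto
  have sq: "f \<longlonglongrightarrow> 0" if "(\<lambda>n. (norm (f n))\<^sup>2) \<longlonglongrightarrow> 0" for f :: "nat \<Rightarrow> 'h"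
    using tendsto_real_sqrt[OF that] by (simp add: tendsto_norm_zero_iff)
  have "bounded ?C" using C by (rule compact_imp_bounded)
  then obtain M where M: "\<And>y. y \<in> ?C \<Longrightarrow> norm y \<le> M" by (auto simp: bounded_iff)
  have weakK: "(\<lambda>n. inner y (K (x n))) \<longlonglongrightarrow> 0" for y
    using weak[of "K' y"] adjoint_pair_inner[OF adjoint_pair_sym[OF adj]] by simp
  have "(\<lambda>n. inner (K (x n)) (K (x n))) \<longlonglongrightarrow> 0"
    by (rule weakly_null_uniform_on_compact[OF C in_C[OF B] M[OF in_C[OF B]] weakK])
  then show "(\<lambda>n. K (x n)) \<longlonglongrightarrow> 0" by (intro sq) (simp add: power2_norm_eq_inner)
  obtain L where L: "L > 0" "\<And>y. norm (K' y) \<le> norm y * L"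
    using K' bounded_linear.pos_bounded unfolding bounded_op_def by blast
  \<comment> \<open>\<open>\<parallel>K' x\<parallel>\<^sup>2 = \<langle>K (K' x), x\<rangle>\<close>, where \<open>K (K' x)\<close> runs through a multiple of the compact set.\<close>
  have "norm ((1 / L) *\<^sub>R K' (x n)) \<le> 1" for n
  proof -
    have "norm (K' (x n)) \<le> 1 * L"
      using L(1) by (intro order.trans[OF L(2)] mult_right_mono B) auto
    then show ?thesis using L(1) by (simp add: field_simps)
  qed
  then have "(\<lambda>n. inner (K ((1 / L) *\<^sub>R K' (x n))) (x n)) \<longlonglongrightarrow> 0"
    by (intro weakly_null_uniform_on_compact[OF C in_C B weak])
  then have "(\<lambda>n. L * inner (K ((1 / L) *\<^sub>R K' (x n))) (x n)) \<longlonglongrightarrow> L * 0"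
    by (rule tendsto_mult_left)
  moreover have "L * inner (K ((1 / L) *\<^sub>R K' (x n))) (x n) = (norm (K' (x n)))\<^sup>2" for n
    using L(1) adjoint_pair_inner[OF adj]
    by (simp add: bounded_op_scaleR[OF Kb] power2_norm_eq_inner)
  ultimately show "(\<lambda>n. K' (x n)) \<longlonglongrightarrow> 0" by (intro sq) simp
qed


section \<open>Operators satisfying the relations of \<open>SU\<^sub>q(2)\<close>\<close>

text \<open>A representation of the relations; \<open>a'\<close> and \<open>b'\<close> are the adjoints of \<open>a\<close> and \<open>b\<close>.\<close>

locale SUq2_operators =
  fixes q :: real and a a' b b' :: "'h::chilbert_space \<Rightarrow> 'h"
  assumes q_pos: "0 < q" and q_less_1: "q < 1"
    and relations: "SUq2_operator_relations q a a' b b'"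
begin

lemma
  shows bounded_a: "bounded_op a" and bounded_a': "bounded_op a'" and bounded_b: "bounded_op b"
    and adj_a: "adjoint_pair a a'" and adj_b: "adjoint_pair b b'"
    and a'_a_eq: "a' (a v) + b' (b v) = v" and a_a'_eq: "a (a' v) + q\<^sup>2 *\<^sub>R b (b' v) = v"
    and a_b: "a (b v) = q *\<^sub>R b (a v)" and a_b': "a (b' v) = q *\<^sub>R b' (a v)"
    and b'_b: "b' (b v) = b (b' v)"
  using relations by (auto simp: SUq2_operator_relations_def)

lemmas adj_a' = adjoint_pair_sym[OF adj_a] and adj_b' = adjoint_pair_sym[OF adj_b]

lemma b'_a': "b' (a' v) = q *\<^sub>R a' (b' v)"
  using adj_a' adj_b' by (intro cinner_eqI)
    (simp add: a_b cinner_scaleR_left cinner_scaleR_right adjoint_pair_def[of a' a]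
      adjoint_pair_def[of b' b] flip: adj_a[unfolded adjoint_pair_def, rule_format]
      adj_b[unfolded adjoint_pair_def, rule_format])

lemma b_a': "b (a' v) = q *\<^sub>R a' (b v)"
  by (intro cinner_eqI)
    (simp add: a_b' cinner_scaleR_left cinner_scaleR_right
      flip: adj_a[unfolded adjoint_pair_def, rule_format]
      adj_b'[unfolded adjoint_pair_def, rule_format])

lemma b_a'_pow: "b ((a' ^^ n) v) = q ^ n *\<^sub>R (a' ^^ n) (b v)"
  by (induction n) (simp_all add: b_a' bounded_op_scaleR[OF bounded_a'])

lemma b'_a'_pow: "b' ((a' ^^ n) v) = q ^ n *\<^sub>R (a' ^^ n) (b' v)"
  by (induction n) (simp_all add: b'_a' bounded_op_scaleR[OF bounded_a'])

lemma a_pow_b: "(a ^^ n) (b v) = q ^ n *\<^sub>R b ((a ^^ n) v)"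
  by (induction n) (simp_all add: a_b bounded_op_scaleR[OF bounded_a] mult.commute)

lemma a_pow_b': "(a ^^ n) (b' v) = q ^ n *\<^sub>R b' ((a ^^ n) v)"
  by (induction n) (simp_all add: a_b' bounded_op_scaleR[OF bounded_a] mult.commute)

text \<open>The operator \<open>a\<^sup>n a'\<^sup>n\<close> is a polynomial in \<open>b b'\<close>, where \<open>b\<close> is normal, so it commutes with \<open>b\<close>
  and \<open>b'\<close>.\<close>

lemma a_pow_a'_pow_b: "(a ^^ n) ((a' ^^ n) (b v)) = b ((a ^^ n) ((a' ^^ n) v))"
proof -
  have "q ^ n *\<^sub>R (a ^^ n) ((a' ^^ n) (b v)) = q ^ n *\<^sub>R b ((a ^^ n) ((a' ^^ n) v))"
    by (metis a_pow_b b_a'_pow bounded_op_scaleR bounded_op_funpow bounded_a)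
  then show ?thesis using q_pos by simp
qed

lemma a_pow_a'_pow_b': "(a ^^ n) ((a' ^^ n) (b' v)) = b' ((a ^^ n) ((a' ^^ n) v))"
proof -
  have "q ^ n *\<^sub>R (a ^^ n) ((a' ^^ n) (b' v)) = q ^ n *\<^sub>R b' ((a ^^ n) ((a' ^^ n) v))"
    by (metis a_pow_b' b'_a'_pow bounded_op_scaleR bounded_op_funpow bounded_a)
  then show ?thesis using q_pos by simp
qed

lemma a_pow_a'_pow_b_pow: "(a ^^ n) ((a' ^^ n) ((b ^^ k) v)) = (b ^^ k) ((a ^^ n) ((a' ^^ n) v))"
  by (induction k) (simp_all add: a_pow_a'_pow_b)

lemma norm_b': "norm (b' v) = norm (b v)"
proof -
  have "inner (b' v) (b' v) = inner (b v) (b v)"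
    by (metis adjoint_pair_inner adj_b b'_b inner_commute)
  then show ?thesis by (simp add: norm_eq_sqrt_inner)
qed

lemma norm_a_b: "(norm (a v))\<^sup>2 + (norm (b v))\<^sup>2 = (norm v)\<^sup>2"
proof -
  have "inner v v = inner v (a' (a v)) + inner v (b' (b v))"
    by (metis a'_a_eq inner_add_right)
  then show ?thesis
    by (simp add: power2_norm_eq_inner adjoint_pair_inner[OF adj_a] adjoint_pair_inner[OF adj_b])
qed

lemma norm_a'_b': "(norm (a' v))\<^sup>2 + q\<^sup>2 * (norm (b' v))\<^sup>2 = (norm v)\<^sup>2"
proof -
  have "inner v v = inner v (a (a' v)) + q\<^sup>2 * inner v (b (b' v))"
    by (metis a_a'_eq inner_add_right inner_scaleR_right)
  then show ?thesis
    by (simp add: power2_norm_eq_inner adjoint_pair_inner[OF adj_a'] adjoint_pair_inner[OF adj_b'])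
qed

lemma norm_b'_le: "norm (b' v) \<le> norm v"
  using norm_a_b[of v] norm_b'[of v] by (smt (verit) norm_ge_zero power2_le_imp_le zero_le_power2)

lemma norm_b_le: "norm (b v) \<le> norm v"
  using norm_b'_le norm_b' by metis

lemma norm_a'_le: "norm (a' v) \<le> norm v"
proof -
  have "(norm (a' v))\<^sup>2 \<le> (norm v)\<^sup>2"
    using norm_a'_b'[of v] by (smt (verit) mult_nonneg_nonneg zero_le_power2)
  then show ?thesis by simp
qed

lemma norm_a'_ge: "(1 - q\<^sup>2) * (norm v)\<^sup>2 \<le> (norm (a' v))\<^sup>2"
proof -
  have "q\<^sup>2 * (norm (b' v))\<^sup>2 \<le> q\<^sup>2 * (norm v)\<^sup>2"
    by (intro mult_left_mono power_mono norm_b'_le) auto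
  then show ?thesis using norm_a'_b'[of v] by (simp add: algebra_simps)
qed

lemma q2_less_1: "q\<^sup>2 < 1"
  using q_pos q_less_1 by (simp add: power_less_one_iff)

lemma q2_pow_less_1: "q\<^sup>2 ^ Suc k < 1"
  using q_pos by (intro power_Suc_less_one q2_less_1) simp

lemma norm_a'_pow_ge: "(1 - q\<^sup>2) ^ n * (norm v)\<^sup>2 \<le> (norm ((a' ^^ n) v))\<^sup>2"
proof (induction n)
  case (Suc n)
  have "(1 - q\<^sup>2) * ((1 - q\<^sup>2) ^ n * (norm v)\<^sup>2) \<le> (1 - q\<^sup>2) * (norm ((a' ^^ n) v))\<^sup>2"
    using q2_less_1 by (intro mult_left_mono Suc.IH) auto
  then show ?case using norm_a'_ge[of "(a' ^^ n) v"] by (simp add: mult.assoc)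
qed simp

lemma a'_pow_eq_0_iff: "(a' ^^ n) v = 0 \<longleftrightarrow> v = 0"
proof
  assume "(a' ^^ n) v = 0"
  then have "(1 - q\<^sup>2) ^ n * (norm v)\<^sup>2 \<le> 0" using norm_a'_pow_ge[of n v] by simp
  moreover have "0 < (1 - q\<^sup>2) ^ n" using q2_less_1 by simp
  ultimately show "v = 0" by (simp add: mult_le_0_iff)
qed (simp add: bounded_op_zero[OF bounded_op_funpow[OF bounded_a']])

lemma norm_a'_pow_antimono: "n \<le> m \<Longrightarrow> norm ((a' ^^ m) v) \<le> norm ((a' ^^ n) v)"
  by (induction rule: dec_induct) (auto intro: order.trans[OF norm_a'_le])

lemma norm_a'_pow_le: "norm ((a' ^^ n) v) \<le> norm v"
  using norm_a'_pow_antimono[of 0 n v] by simp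

lemma norm_b_pow_le: "norm ((b ^^ n) v) \<le> norm v"
  by (induction n) (auto intro: order.trans[OF norm_b_le])

lemma a'_pow_tendsto_b':
  assumes "(\<lambda>n. (a' ^^ n) v) \<longlonglongrightarrow> 0"
  shows "(\<lambda>n. (a' ^^ n) (b' v)) \<longlonglongrightarrow> 0"
proof -
  have "(norm ((a' ^^ n) (b' v)))\<^sup>2 \<le> norm v * norm ((a' ^^ n) v)" for n
  proof -
    have "(norm ((a' ^^ n) (b' v)))\<^sup>2 = inner (b' v) ((a ^^ n) ((a' ^^ n) (b' v)))"
      by (simp add: power2_norm_eq_inner adjoint_pair_inner[OF adjoint_pair_funpow[OF adj_a']])
    also have "\<dots> = inner (b (b' v)) ((a ^^ n) ((a' ^^ n) v))"
      by (simp add: a_pow_a'_pow_b' adjoint_pair_inner[OF adj_b])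
    also have "\<dots> = inner ((a' ^^ n) (b (b' v))) ((a' ^^ n) v)"
      by (simp add: adjoint_pair_inner[OF adjoint_pair_funpow[OF adj_a']])
    also have "\<dots> \<le> norm ((a' ^^ n) (b (b' v))) * norm ((a' ^^ n) v)"
      by (rule norm_cauchy_schwarz)
    also have "\<dots> \<le> norm v * norm ((a' ^^ n) v)"
      by (intro mult_right_mono order.trans[OF norm_a'_pow_le] order.trans[OF norm_b_le] norm_b'_le)
        auto
    finally show ?thesis .
  qed
  then have le: "norm ((norm ((a' ^^ n) (b' v)))\<^sup>2) \<le> norm v * norm ((a' ^^ n) v)" for n
    by simp
  have "(\<lambda>n. norm v * norm ((a' ^^ n) v)) \<longlonglongrightarrow> 0"
    by (rule tendsto_mult_right_zero[OF tendsto_norm_zero[OF assms]])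
  then have "(\<lambda>n. (norm ((a' ^^ n) (b' v)))\<^sup>2) \<longlonglongrightarrow> 0"
    by (rule Lim_null_comparison[OF always_eventually[OF allI[OF le]]])
  from tendsto_real_sqrt[OF this] show ?thesis by (simp add: tendsto_norm_zero_iff)
qed

text \<open>This telescopes the identities \<open>\<parallel>a'\<^sup>n v\<parallel>\<^sup>2 - \<parallel>a'\<^sup>n\<^sup>+\<^sup>1 v\<parallel>\<^sup>2 = q\<^sup>2 \<parallel>b' a'\<^sup>n v\<parallel>\<^sup>2\<close>, whose right-hand sides
  decay geometrically because \<open>b'\<close> and \<open>a'\<close> commute up to a factor \<open>q\<close>.\<close>

lemma norm_a'_pow_diff:
  "(norm ((a' ^^ k) v))\<^sup>2 - (norm ((a' ^^ (k + m)) v))\<^sup>2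
     \<le> q ^ (2 * k) * (\<Sum>l<m. q\<^sup>2 ^ Suc l) * (norm ((a' ^^ k) (b' v)))\<^sup>2"
proof (induction m)
  case (Suc m)
  have "(norm ((a' ^^ (k + m)) v))\<^sup>2 - (norm ((a' ^^ (k + Suc m)) v))\<^sup>2
      = q\<^sup>2 * (norm (b' ((a' ^^ (k + m)) v)))\<^sup>2"
    using norm_a'_b'[of "(a' ^^ (k + m)) v"] by simp
  also have "\<dots> = q ^ (2 * k) * q\<^sup>2 ^ Suc m * (norm ((a' ^^ (k + m)) (b' v)))\<^sup>2"
    using q_pos by (simp add: b'_a'_pow power_mult_distrib power_add power_mult power2_eq_square)
  also have "\<dots> \<le> q ^ (2 * k) * q\<^sup>2 ^ Suc m * (norm ((a' ^^ k) (b' v)))\<^sup>2"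
    using q_pos by (intro mult_left_mono power_mono norm_a'_pow_antimono) auto
  finally show ?case using Suc.IH by (simp add: algebra_simps)
qed simp

lemma norm_a'_pow_le_b':
  assumes "(\<lambda>n. (a' ^^ n) v) \<longlonglongrightarrow> 0"
  shows "(norm ((a' ^^ k) v))\<^sup>2 \<le> q ^ (2 * k) * (1 / (1 - q\<^sup>2)) * (norm ((a' ^^ k) (b' v)))\<^sup>2"
proof -
  have "(\<Sum>l<m. q\<^sup>2 ^ Suc l) \<le> 1 / (1 - q\<^sup>2)" for m
  proof -
    have "(\<Sum>l<m. q\<^sup>2 ^ Suc l) \<le> (\<Sum>l<m. q\<^sup>2 ^ l)"
      using q2_less_1 by (intro sum_mono) (simp add: mult_left_le_one_le)
    also have "\<dots> = (1 - q\<^sup>2 ^ m) / (1 - q\<^sup>2)"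
      using q2_less_1 by (simp add: sum_gp_strict)
    also have "\<dots> \<le> 1 / (1 - q\<^sup>2)"
      using q2_less_1 by (intro divide_right_mono) auto
    finally show ?thesis .
  qed
  then have sum_le: "q ^ (2 * k) * (\<Sum>l<m. q\<^sup>2 ^ Suc l) * (norm ((a' ^^ k) (b' v)))\<^sup>2
      \<le> q ^ (2 * k) * (1 / (1 - q\<^sup>2)) * (norm ((a' ^^ k) (b' v)))\<^sup>2" for m
    using q_pos by (intro mult_right_mono mult_left_mono) auto
  have le: "(norm ((a' ^^ k) v))\<^sup>2 - (norm ((a' ^^ (m + k)) v))\<^sup>2
      \<le> q ^ (2 * k) * (1 / (1 - q\<^sup>2)) * (norm ((a' ^^ k) (b' v)))\<^sup>2" for m
    unfolding add.commute[of m k] by (rule order.trans[OF norm_a'_pow_diff sum_le])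
  have "(\<lambda>m. (norm ((a' ^^ k) v))\<^sup>2 - (norm ((a' ^^ (m + k)) v))\<^sup>2)
      \<longlonglongrightarrow> (norm ((a' ^^ k) v))\<^sup>2 - (norm (0::'h))\<^sup>2"
    by (intro tendsto_diff tendsto_const tendsto_power tendsto_norm LIMSEQ_ignore_initial_segment assms)
  then have "(norm ((a' ^^ k) v))\<^sup>2 - (norm (0::'h))\<^sup>2
      \<le> q ^ (2 * k) * (1 / (1 - q\<^sup>2)) * (norm ((a' ^^ k) (b' v)))\<^sup>2"
    by (rule LIMSEQ_le_const2) (use le in blast)
  then show ?thesis by simp
qed

text \<open>The previous estimate bounds \<open>\<parallel>a'\<^sup>k v\<parallel>\<close> by \<open>\<parallel>a'\<^sup>k b' v\<parallel>\<close>, with a constant below 1 for large \<open>k\<close>. As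
  \<open>b' v\<close> satisfies the same hypothesis and \<open>b'\<close> is a contraction, the estimate can be iterated.\<close>

lemma a'_pow_tendsto_0_imp:
  assumes "(\<lambda>n. (a' ^^ n) v) \<longlonglongrightarrow> 0"
  shows "v = 0"
proof -
  define C where "C = 1 / (1 - q\<^sup>2)"
  have C: "0 < C" using q2_less_1 by (simp add: C_def)
  have "(\<lambda>k. (q\<^sup>2) ^ k * C) \<longlonglongrightarrow> 0 * C"
    using q2_less_1 by (intro tendsto_mult_right LIMSEQ_realpow_zero) auto
  then have "\<forall>\<^sub>F k in sequentially. (q\<^sup>2) ^ k * C < 1 / 2"
    by (intro order_tendstoD) auto
  then obtain k where k: "q ^ (2 * k) * C < 1 / 2"
    by (auto simp: eventually_sequentially power_mult)
  have *: "(norm ((a' ^^ k) w))\<^sup>2 \<le> (1 / 2) ^ j * (norm w)\<^sup>2" if "(\<lambda>n. (a' ^^ n) w) \<longlonglongrightarrow> 0" for w j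
    using that
  proof (induction j arbitrary: w)
    case 0
    then show ?case using norm_a'_pow_le by (simp add: power_mono)
  next
    case (Suc j)
    have "(norm ((a' ^^ k) w))\<^sup>2 \<le> q ^ (2 * k) * C * (norm ((a' ^^ k) (b' w)))\<^sup>2"
      using norm_a'_pow_le_b'[OF Suc.prems] by (simp add: C_def)
    also have "\<dots> \<le> (1 / 2) * ((1 / 2) ^ j * (norm (b' w))\<^sup>2)"
      using k by (intro mult_mono Suc.IH a'_pow_tendsto_b' Suc.prems) auto
    also have "\<dots> \<le> (1 / 2) * ((1 / 2) ^ j * (norm w)\<^sup>2)"
      by (intro mult_left_mono power_mono norm_b'_le) auto
    finally show ?case by simp
  qed
  have "(\<lambda>j. (1 / 2) ^ j * (norm v)\<^sup>2) \<longlonglongrightarrow> 0 * (norm v)\<^sup>2"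
    by (intro tendsto_mult_right LIMSEQ_realpow_zero) auto
  then have "(norm ((a' ^^ k) v))\<^sup>2 \<le> 0 * (norm v)\<^sup>2"
    by (rule LIMSEQ_le_const) (use *[OF assms] in auto)
  then show ?thesis using a'_pow_eq_0_iff by simp
qed

end

section \<open>The canonical basis and its weight spaces\<close>

lemma spin_index_iff:
  "(n, i, j) \<in> spin_index \<longleftrightarrow>
     (\<exists>N k l :: nat. k \<le> N \<and> l \<le> N \<and> n = real N / 2 \<and> i = - n + real k \<and> j = - n + real l)"
  by (auto simp: spin_index_def)

lemma spin_index_bounds:
  assumes "(n, i, j) \<in> spin_index"
  shows "\<bar>i\<bar> \<le> n" "\<bar>j\<bar> \<le> n"
  using assms by (auto simp: spin_index_iff)

lemma spin_index_diag: "(real N / 2, real N / 2, real N / 2) \<in> spin_index"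
  unfolding spin_index_iff by (intro exI[of _ N]) auto

lemma spin_index_antidiag: "(real N / 2, real N / 2, - (real N / 2)) \<in> spin_index"
  unfolding spin_index_iff by (rule exI[of _ N], rule exI[of _ N], rule exI[of _ 0]) auto

text \<open>The representation in the basis \<open>e\<close>, together with the self-adjoint unitary \<open>F\<close> that is diagonal
  in this basis with eigenvalue \<open>-1\<close> exactly at the vectors with \<open>i = n\<close>.\<close>

locale SUq2_basis = SUq2_operators q a a' b b'
  for q a and a' b b' :: "'h::chilbert_space \<Rightarrow> 'h" +
  fixes e :: "real \<times> real \<times> real \<Rightarrow> 'h" and F :: "'h \<Rightarrow> 'h"
  assumes onb: "orthonormal_basis_on spin_index e"
    and a_e: "(n, i, j) \<in> spin_index \<Longrightarrow>
      a (e (n, i, j)) = a_plus q n i j *\<^sub>R basis_vec e (n + 1/2) (i - 1/2) (j - 1/2) +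
                        a_minus q n i j *\<^sub>R basis_vec e (n - 1/2) (i - 1/2) (j - 1/2)"
    and b_e: "(n, i, j) \<in> spin_index \<Longrightarrow>
      b (e (n, i, j)) = b_plus q n i j *\<^sub>R basis_vec e (n + 1/2) (i + 1/2) (j - 1/2) +
                        b_minus q n i j *\<^sub>R basis_vec e (n - 1/2) (i + 1/2) (j - 1/2)"
    and bounded_F: "bounded_op F" and adj_F: "adjoint_pair F F"
    and F_e: "(n, i, j) \<in> spin_index \<Longrightarrow> F (e (n, i, j)) = (if i = n then - e (n, i, j) else e (n, i, j))"
begin

abbreviation e\<^sub>0 :: 'h where "e\<^sub>0 \<equiv> e (0, 0, 0)"

lemma spin_index_0: "(0, 0, 0) \<in> spin_index"
  using spin_index_diag[of 0] by simp

lemma cinner_e: "k \<in> spin_index \<Longrightarrow> l \<in> spin_index \<Longrightarrow> cinner (e k) (e l) = (if k = l then 1 else 0)"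
  using onb by (simp add: orthonormal_basis_on_def)

lemma cinner_e_basis_vec:
  "(m, r, s) \<in> spin_index \<Longrightarrow>
     cinner (e (m, r, s)) (basis_vec e n i j) = (if m = n \<and> r = i \<and> s = j then 1 else 0)"
  by (auto simp: basis_vec_def cinner_e)

lemma norm_e: "k \<in> spin_index \<Longrightarrow> norm (e k) = 1"
proof -
  assume "k \<in> spin_index"
  then have "complex_of_real ((norm (e k))\<^sup>2) = complex_of_real 1"
    using cinner_e[of k k] by (simp add: cinner_self)
  then have "(norm (e k))\<^sup>2 = 1" by (simp only: of_real_eq_iff)
  then show ?thesis by (simp add: power2_eq_1_iff) (smt (verit) norm_ge_zero)
qed

lemma basis_dense:
  assumes "csubspace S" "closed S" "\<And>k. k \<in> spin_index \<Longrightarrow> e k \<in> S"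
  shows "x \<in> S"
  using onb assms unfolding orthonormal_basis_on_def by blast

lemma basis_eqI:
  assumes "\<And>n i j. (n, i, j) \<in> spin_index \<Longrightarrow> cinner (e (n, i, j)) x = cinner (e (n, i, j)) y"
  shows "x = y"
proof -
  have "x - y \<in> {z. cinner z (x - y) = 0}"
  proof (rule basis_dense)
    show "csubspace {z. cinner z (x - y) = 0}"
      by (auto simp: csubspace_def cinner_add_left cinner_scaleC_left)
    show "closed {z. cinner z (x - y) = 0}" by (rule closed_cinner_kernel)
  qed (use assms in \<open>auto simp: cinner_diff_right\<close>)
  then show ?thesis by (simp add: cinner_self)
qed

text \<open>The two terms exchange their roles, as \<open>S'\<close> leads to \<open>n + 1/2\<close> where \<open>S\<close> leads back from there.\<close>

lemma adjoint_action:
  fixes p m :: "real \<Rightarrow> real \<Rightarrow> real \<Rightarrow> real" and c d :: real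
  assumes adj: "adjoint_pair S S'"
    and S: "\<And>n i j. (n, i, j) \<in> spin_index \<Longrightarrow>
      S (e (n, i, j)) = p n i j *\<^sub>R basis_vec e (n + 1/2) (i + c) (j + d) +
                        m n i j *\<^sub>R basis_vec e (n - 1/2) (i + c) (j + d)"
    and nij: "(n, i, j) \<in> spin_index"
  shows "S' (e (n, i, j)) =
      m (n + 1/2) (i - c) (j - d) *\<^sub>R basis_vec e (n + 1/2) (i - c) (j - d) +
      p (n - 1/2) (i - c) (j - d) *\<^sub>R basis_vec e (n - 1/2) (i - c) (j - d)" (is "_ = ?rhs")
proof (rule basis_eqI)
  fix n' i' j' assume 1: "(n', i', j') \<in> spin_index"
  have "cinner (basis_vec e r s t) (e (n, i, j)) = (if n = r \<and> i = s \<and> j = t then 1 else 0)" for r s t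
    using cinner_e_basis_vec[OF nij, of r s t] cinner_commute[of "basis_vec e r s t" "e (n, i, j)"]
    by (auto split: if_splits)
  moreover have "cinner (e (n', i', j')) (S' (e (n, i, j))) = cinner (S (e (n', i', j'))) (e (n, i, j))"
    using adj by (simp add: adjoint_pair_def)
  ultimately show "cinner (e (n', i', j')) (S' (e (n, i, j))) = cinner (e (n', i', j')) ?rhs"
    using 1 by (auto simp: S cinner_e_basis_vec cinner_add_left cinner_add_right cinner_scaleR_left
        cinner_scaleR_right)
qed

lemma a'_e: "(n, i, j) \<in> spin_index \<Longrightarrow>
    a' (e (n, i, j)) =
      a_minus q (n + 1/2) (i + 1/2) (j + 1/2) *\<^sub>R basis_vec e (n + 1/2) (i + 1/2) (j + 1/2) +
      a_plus q (n - 1/2) (i + 1/2) (j + 1/2) *\<^sub>R basis_vec e (n - 1/2) (i + 1/2) (j + 1/2)"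
  using adjoint_action[OF adj_a, of "a_plus q" "- (1/2)" "- (1/2)" "a_minus q"] a_e by simp

lemma b'_e: "(n, i, j) \<in> spin_index \<Longrightarrow>
    b' (e (n, i, j)) =
      b_minus q (n + 1/2) (i - 1/2) (j + 1/2) *\<^sub>R basis_vec e (n + 1/2) (i - 1/2) (j + 1/2) +
      b_plus q (n - 1/2) (i - 1/2) (j + 1/2) *\<^sub>R basis_vec e (n - 1/2) (i - 1/2) (j + 1/2)"
  using adjoint_action[OF adj_b, of "b_plus q" "1/2" "- (1/2)" "b_minus q"] b_e by simp

text \<open>The weight space of \<open>(i, j)\<close> is the closed span of the \<open>e(n, i, j)\<close> for all \<open>n\<close>, described here as
  the orthogonal complement of the other basis vectors.\<close>

definition H :: "real \<Rightarrow> real \<Rightarrow> 'h set" where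
  "H i j = {x. \<forall>n k l. (n, k, l) \<in> spin_index \<longrightarrow> (k, l) \<noteq> (i, j) \<longrightarrow> cinner (e (n, k, l)) x = 0}"

lemma H_D: "x \<in> H i j \<Longrightarrow> (n, k, l) \<in> spin_index \<Longrightarrow> (k, l) \<noteq> (i, j) \<Longrightarrow> cinner (e (n, k, l)) x = 0"
  by (simp add: H_def)

lemma csubspace_H: "csubspace (H i j)"
  by (auto simp: csubspace_def H_def cinner_add_right cinner_scaleC_right)

lemma
  shows H_zero: "0 \<in> H i j"
    and H_add: "x \<in> H i j \<Longrightarrow> y \<in> H i j \<Longrightarrow> x + y \<in> H i j"
    and H_scaleC: "x \<in> H i j \<Longrightarrow> c *\<^sub>C x \<in> H i j"
    and H_diff: "x \<in> H i j \<Longrightarrow> y \<in> H i j \<Longrightarrow> x - y \<in> H i j"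
  by (auto simp: H_def cinner_add_right cinner_scaleC_right cinner_diff_right)

lemma closed_H: "closed (H i j)"
proof -
  have "H i j = (\<Inter>(n, k, l) \<in> {(n, k, l). (n, k, l) \<in> spin_index \<and> (k, l) \<noteq> (i, j)}.
      {x. cinner (e (n, k, l)) x = 0})"
    by (fastforce simp: H_def)
  then show ?thesis by (auto intro!: closed_INT closed_cinner_kernel')
qed

lemma e_in_H: "(n, i, j) \<in> spin_index \<Longrightarrow> e (n, i, j) \<in> H i j"
  by (auto simp: H_def cinner_e)

lemma cinner_basis_vec_H: "x \<in> H i j \<Longrightarrow> (k, l) \<noteq> (i, j) \<Longrightarrow> cinner (basis_vec e n k l) x = 0"
  unfolding basis_vec_def using H_D by simp

lemma H_eqI:
  assumes "x \<in> H i j" "y \<in> H i j"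
    and "\<And>n. (n, i, j) \<in> spin_index \<Longrightarrow> cinner (e (n, i, j)) x = cinner (e (n, i, j)) y"
  shows "x = y"
  using assms H_D by (intro basis_eqI) (metis (no_types, lifting) prod.inject)

lemma a_H: "x \<in> H i j \<Longrightarrow> a x \<in> H (i - 1/2) (j - 1/2)"
  unfolding H_def[of "i - 1/2"]
  by (auto simp: a'_e cinner_add_left cinner_scaleR_left cinner_basis_vec_H
      adj_a'[unfolded adjoint_pair_def, rule_format, symmetric])

lemma a'_H: "x \<in> H i j \<Longrightarrow> a' x \<in> H (i + 1/2) (j + 1/2)"
  unfolding H_def[of "i + 1/2"]
  by (auto simp: a_e cinner_add_left cinner_scaleR_left cinner_basis_vec_H
      adj_a[unfolded adjoint_pair_def, rule_format, symmetric])

lemma b_H: "x \<in> H i j \<Longrightarrow> b x \<in> H (i + 1/2) (j - 1/2)"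
  unfolding H_def[of "i + 1/2"]
  by (auto simp: b'_e cinner_add_left cinner_scaleR_left cinner_basis_vec_H
      adj_b'[unfolded adjoint_pair_def, rule_format, symmetric])

lemma b'_H: "x \<in> H i j \<Longrightarrow> b' x \<in> H (i - 1/2) (j + 1/2)"
  unfolding H_def[of "i - 1/2"]
  by (auto simp: b_e cinner_add_left cinner_scaleR_left cinner_basis_vec_H
      adj_b[unfolded adjoint_pair_def, rule_format, symmetric])

lemma funpow_H:
  assumes S: "\<And>x i j. x \<in> H i j \<Longrightarrow> S x \<in> H (i + c) (j + d)" and "x \<in> H i j"
  shows "(S ^^ n) x \<in> H (i + real n * c) (j + real n * d)"
proof (induction n)
  case (Suc n)
  from S[OF Suc.IH] show ?case by (simp add: algebra_simps)
qed (use assms in simp)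

lemma a_pow_H: "x \<in> H i j \<Longrightarrow> (a ^^ n) x \<in> H (i - real n / 2) (j - real n / 2)"
  using funpow_H[of a "- (1/2)" "- (1/2)"] a_H by simp

lemma a'_pow_H: "x \<in> H i j \<Longrightarrow> (a' ^^ n) x \<in> H (i + real n / 2) (j + real n / 2)"
  using funpow_H[of a' "1/2" "1/2"] a'_H by simp

lemma b_pow_H: "x \<in> H i j \<Longrightarrow> (b ^^ n) x \<in> H (i + real n / 2) (j - real n / 2)"
  using funpow_H[of b "1/2" "- (1/2)"] b_H by simp

lemma b'_pow_H: "x \<in> H i j \<Longrightarrow> (b' ^^ n) x \<in> H (i - real n / 2) (j + real n / 2)"
  using funpow_H[of b' "- (1/2)" "1/2"] b'_H by simp

lemma cinner_e_F:
  "(n, i, j) \<in> spin_index \<Longrightarrow>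
     cinner (e (n, i, j)) (F x) = (if i = n then -1 else 1) * cinner (e (n, i, j)) x"
  using adj_F by (auto simp: adjoint_pair_def F_e cinner_minus_left
      simp flip: adj_F[unfolded adjoint_pair_def, rule_format])

lemma F_H: "x \<in> H i j \<Longrightarrow> F x \<in> H i j"
  by (auto simp: H_def cinner_e_F)

lemma F_fixes_H:
  assumes "(i, i, j) \<notin> spin_index" "x \<in> H i j"
  shows "F x = x"
  using assms by (intro H_eqI[of _ i j] F_H) (auto simp: cinner_e_F)

lemma F_reflects_H:
  assumes "(i, i, j) \<in> spin_index" "x \<in> H i j"
  shows "F x + x = 2 *\<^sub>R (x - cinner (e (i, i, j)) x *\<^sub>C e (i, i, j))"
proof (rule H_eqI[of _ i j])
  show "F x + x \<in> H i j" using assms by (intro H_add F_H)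
  show "2 *\<^sub>R (x - cinner (e (i, i, j)) x *\<^sub>C e (i, i, j)) \<in> H i j"
    using assms by (auto intro!: H_scaleC H_diff e_in_H simp flip: scaleC_of_real)
qed (use assms in \<open>auto simp: cinner_e_F cinner_add_right cinner_diff_right cinner_scaleC_right
      cinner_scaleR_right cinner_e\<close>)

lemma a'_pow_e0:
  obtains c where "(a' ^^ N) e\<^sub>0 = c *\<^sub>R e (real N / 2, real N / 2, real N / 2)"
proof -
  have "\<exists>c. (a' ^^ N) e\<^sub>0 = c *\<^sub>R e (real N / 2, real N / 2, real N / 2)"
  proof (induction N)
    case 0
    then show ?case by (intro exI[of _ 1]) simp
  next
    case (Suc N)
    then obtain c where c: "(a' ^^ N) e\<^sub>0 = c *\<^sub>R e (real N / 2, real N / 2, real N / 2)" ..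
    let ?n = "real N / 2 + 1/2"
    have "(real N / 2 - 1/2, ?n, ?n) \<notin> spin_index"
      using spin_index_bounds(1) by fastforce
    then have "basis_vec e (real N / 2 - 1/2) ?n ?n = 0" by (simp add: basis_vec_def)
    moreover have "basis_vec e ?n ?n ?n = e (?n, ?n, ?n)"
      using spin_index_diag[of "Suc N"] by (simp add: basis_vec_def add_divide_distrib add.commute)
    ultimately have "(a' ^^ Suc N) e\<^sub>0 = (c * a_minus q ?n ?n ?n) *\<^sub>R e (?n, ?n, ?n)"
      by (simp add: c bounded_op_scaleR[OF bounded_a'] a'_e[OF spin_index_diag])
    moreover have n: "real (Suc N) / 2 = ?n" by (simp add: add_divide_distrib)
    ultimately show ?case unfolding n by (intro exI)
  qed
  then show ?thesis using that by blast
qed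

text \<open>These coefficients give \<open>\<parallel>b\<^sup>N e\<^sub>0\<parallel>\<^sup>2\<close> as a telescoping product, which equals
  \<open>(1 - q\<^sup>2) / (1 - q\<^sup>2\<^sup>N\<^sup>+\<^sup>2)\<close>.\<close>

lemma b_plus_highest:
  "(b_plus q (real N / 2) (real N / 2) (- (real N / 2)))\<^sup>2 = (1 - q\<^sup>2 ^ Suc N) / (1 - q\<^sup>2 ^ Suc (Suc N))"
proof -
  have "q powr real (2 * Suc N) = q\<^sup>2 ^ Suc N" "q powr real (2 * Suc (Suc N)) = q\<^sup>2 ^ Suc (Suc N)"
    unfolding powr_realpow[OF q_pos] by (rule power_mult)+
  then have q: "q powr (2 * real N + 2) = q\<^sup>2 ^ Suc N" "q powr (2 * real N + 4) = q\<^sup>2 ^ Suc (Suc N)"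
    by (simp_all add: add.commute)
  have "(1 - q\<^sup>2 ^ Suc N) * (1 - q\<^sup>2 ^ Suc N) / ((1 - q\<^sup>2 ^ Suc N) * (1 - q\<^sup>2 ^ Suc (Suc N)))
    = (1 - q\<^sup>2 ^ Suc N) / (1 - q\<^sup>2 ^ Suc (Suc N))"
    using q2_pow_less_1[of N] by simp
  moreover have "(1 - q\<^sup>2 ^ Suc N) / (1 - q\<^sup>2 ^ Suc (Suc N)) \<ge> 0"
    using q2_pow_less_1[of N] q2_pow_less_1[of "Suc N"] by (intro divide_nonneg_nonneg) auto
  ultimately show ?thesis
    using q_pos by (simp add: b_plus_def q del: power_Suc)
qed

lemma b_pow_e0:
  obtains c where "(b ^^ N) e\<^sub>0 = c *\<^sub>R e (real N / 2, real N / 2, - (real N / 2))" "1 - q\<^sup>2 \<le> c\<^sup>2"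
proof -
  have "\<exists>c. (b ^^ N) e\<^sub>0 = c *\<^sub>R e (real N / 2, real N / 2, - (real N / 2)) \<and>
      c\<^sup>2 * (1 - q\<^sup>2 ^ Suc N) = 1 - q\<^sup>2"
  proof (induction N)
    case 0
    then show ?case by (intro exI[of _ 1]) simp
  next
    case (Suc N)
    then obtain c where c: "(b ^^ N) e\<^sub>0 = c *\<^sub>R e (real N / 2, real N / 2, - (real N / 2))"
        "c\<^sup>2 * (1 - q\<^sup>2 ^ Suc N) = 1 - q\<^sup>2" by blast
    let ?n = "real N / 2 + 1/2" and ?p = "b_plus q (real N / 2) (real N / 2) (- (real N / 2))"
    have n: "real (Suc N) / 2 = ?n" "- (real N / 2) - 1/2 = - ?n" by (simp_all add: add_divide_distrib)
    have "(real N / 2 - 1/2, ?n, - ?n) \<notin> spin_index"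
      using spin_index_bounds(1) by fastforce
    then have "basis_vec e (real N / 2 - 1/2) ?n (- ?n) = 0" by (simp only: basis_vec_def if_False)
    moreover have "basis_vec e ?n ?n (- ?n) = e (?n, ?n, - ?n)"
      using spin_index_antidiag[of "Suc N"] unfolding n by (simp only: basis_vec_def if_True)
    ultimately have "(b ^^ Suc N) e\<^sub>0 = (c * ?p) *\<^sub>R e (?n, ?n, - ?n)"
      using b_e[OF spin_index_antidiag, of N] unfolding n
      by (simp add: c bounded_op_scaleR[OF bounded_b])
    moreover have "(c * ?p)\<^sup>2 * (1 - q\<^sup>2 ^ Suc (Suc N)) = 1 - q\<^sup>2"
      using c(2) q2_pow_less_1[of "Suc N"]
      by (simp add: power_mult_distrib b_plus_highest del: power_Suc)
    ultimately show ?case unfolding n by (intro exI conjI)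
  qed
  then obtain c where c: "(b ^^ N) e\<^sub>0 = c *\<^sub>R e (real N / 2, real N / 2, - (real N / 2))"
      "c\<^sup>2 * (1 - q\<^sup>2 ^ Suc N) = 1 - q\<^sup>2" by blast
  have "c\<^sup>2 * (1 - q\<^sup>2 ^ Suc N) \<le> c\<^sup>2 * 1"
    by (intro mult_left_mono) auto
  with c show ?thesis by (intro that[of c]) auto
qed


text \<open>The vectors against which the sequence tends to zero form a closed subspace that contains the
  basis.\<close>

lemma weakly_null_multiples:
  assumes k: "inj k" "\<And>n. k n \<in> spin_index" and x: "\<And>n. x n = c n *\<^sub>R e (k n)"
    and le: "\<And>n. norm (x n) \<le> 1"
  shows "(\<lambda>n. inner y (x n)) \<longlonglongrightarrow> 0"
proof -
  let ?S = "{y. (\<lambda>n. cinner y (x n)) \<longlonglongrightarrow> 0}"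
  have "y \<in> ?S"
  proof (rule basis_dense)
    show "csubspace ?S"
      unfolding csubspace_def
      by (auto simp: cinner_add_left cinner_scaleC_left intro: tendsto_add_zero tendsto_mult_right_zero)
  next
    show "closed ?S"
      unfolding closed_sequential_limits
    proof (intro allI impI, elim conjE)
      fix f y assume f: "\<forall>n. f n \<in> ?S" "f \<longlonglongrightarrow> y"
      show "y \<in> ?S"
      proof (rule CollectI, rule LIMSEQ_I)
        fix r :: real assume r: "0 < r"
        then obtain m where m: "norm (f m - y) < r / 2"
          using LIMSEQ_D[OF f(2), of "r / 2"] by auto
        have "(\<lambda>n. cinner (f m) (x n)) \<longlonglongrightarrow> 0" using f(1) by simp
        then obtain M where M: "\<And>n. n \<ge> M \<Longrightarrow> norm (cinner (f m) (x n)) < r / 2"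
          using LIMSEQ_D[of _ 0 "r / 2"] r by fastforce
        have "norm (cinner y (x n)) < r" if "n \<ge> M" for n
        proof -
          have "norm (cinner (f m - y) (x n)) \<le> norm (f m - y) * 1"
            by (rule order.trans[OF norm_cinner_le]) (intro mult_left_mono le norm_ge_zero)
          then show ?thesis
            using m M[OF that] norm_triangle_ineq4[of "cinner (f m) (x n)" "cinner (f m - y) (x n)"]
            by (simp add: cinner_diff_left)
        qed
        then show "\<exists>M. \<forall>n\<ge>M. norm (cinner y (x n) - 0) < r" by auto
      qed
    qed
  next
    fix l assume l: "l \<in> spin_index"
    have "finite {n. k n = l}"
      using k(1) by (intro finite_subset[OF _ finite_vimageI[of "{l}" k]]) auto
    then have "\<forall>\<^sub>F n in sequentially. k n \<noteq> l"
      by (simp add: eventually_cofinite flip: cofinite_eq_sequentially)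
    then have "\<forall>\<^sub>F n in sequentially. cinner (e l) (x n) = 0"
      by eventually_elim (use l k(2) in \<open>auto simp: x cinner_scaleR_right cinner_e\<close>)
    then show "e l \<in> ?S" by (simp add: tendsto_eventually)
  qed
  then have "(\<lambda>n. Re (cinner y (x n))) \<longlonglongrightarrow> Re 0" by (intro tendsto_Re) simp
  then show ?thesis by (simp add: inner_eq_Re_cinner)
qed

lemma F_a'_pow_e0: "F ((a' ^^ N) e\<^sub>0) = - (a' ^^ N) e\<^sub>0"
proof -
  obtain c where "(a' ^^ N) e\<^sub>0 = c *\<^sub>R e (real N / 2, real N / 2, real N / 2)" by (rule a'_pow_e0)
  then show ?thesis by (simp add: bounded_op_scaleR[OF bounded_F] F_e spin_index_diag)
qed

lemma F_b_pow_e0: "F ((b ^^ N) e\<^sub>0) = - (b ^^ N) e\<^sub>0"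
proof -
  obtain c where "(b ^^ N) e\<^sub>0 = c *\<^sub>R e (real N / 2, real N / 2, - (real N / 2))" by (rule b_pow_e0)
  then show ?thesis by (simp add: bounded_op_scaleR[OF bounded_F] F_e spin_index_antidiag)
qed

lemma norm_e0: "norm e\<^sub>0 = 1"
  by (rule norm_e[OF spin_index_0])

lemma weakly_null_a'_pow: "(\<lambda>N. inner y ((a' ^^ N) e\<^sub>0)) \<longlonglongrightarrow> 0"
proof -
  have "\<forall>N. \<exists>c. (a' ^^ N) e\<^sub>0 = c *\<^sub>R e (real N / 2, real N / 2, real N / 2)"
    using a'_pow_e0 by metis
  then obtain c where "\<And>N. (a' ^^ N) e\<^sub>0 = c N *\<^sub>R e (real N / 2, real N / 2, real N / 2)" by metis
  then show ?thesis
    using norm_a'_pow_le[of _ "e\<^sub>0"] norm_e0 spin_index_diag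
    by (intro weakly_null_multiples[where c = c and k = "\<lambda>N. (real N / 2, real N / 2, real N / 2)"])
      (auto simp: inj_on_def)
qed

lemma weakly_null_b_pow: "(\<lambda>N. inner y ((b ^^ N) e\<^sub>0)) \<longlonglongrightarrow> 0"
proof -
  have "\<forall>N. \<exists>c. (b ^^ N) e\<^sub>0 = c *\<^sub>R e (real N / 2, real N / 2, - (real N / 2))"
    using b_pow_e0 by metis
  then obtain c where "\<And>N. (b ^^ N) e\<^sub>0 = c N *\<^sub>R e (real N / 2, real N / 2, - (real N / 2))" by metis
  then show ?thesis
    using norm_b_pow_le[of _ "e\<^sub>0"] norm_e0 spin_index_antidiag
    by (intro weakly_null_multiples[where c = c and k = "\<lambda>N. (real N / 2, real N / 2, - (real N / 2))"])
      (auto simp: inj_on_def)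
qed

lemma norm_b_pow_e0_ge: "1 - q\<^sup>2 \<le> (norm ((b ^^ N) e\<^sub>0))\<^sup>2"
proof -
  obtain c where "(b ^^ N) e\<^sub>0 = c *\<^sub>R e (real N / 2, real N / 2, - (real N / 2))" "1 - q\<^sup>2 \<le> c\<^sup>2"
    by (rule b_pow_e0)
  then show ?thesis by (simp add: norm_e spin_index_antidiag)
qed

section \<open>Homogeneous elements\<close>

text \<open>The bounded operators in the commutant of the generators and their adjoints.\<close>

definition commuting :: "('h \<Rightarrow> 'h) \<Rightarrow> bool" where
  "commuting S \<longleftrightarrow> bounded_op S \<and> (\<forall>x. S (a x) = a (S x)) \<and> (\<forall>x. S (a' x) = a' (S x)) \<and>
     (\<forall>x. S (b x) = b (S x)) \<and> (\<forall>x. S (b' x) = b' (S x))"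

text \<open>\<open>hom_vec i j\<close> contains the vectors \<open>X e\<^sub>0\<close> for all polynomials \<open>X\<close> in the generators and their
  adjoints that are homogeneous of degree \<open>(i, j)\<close>. Instead of polynomials, the definition admits all
  operators \<open>X\<close> with the two relevant properties: an adjoint of \<open>X\<close> shifts the weight by \<open>(-i, -j)\<close>, and
  \<open>X\<close> commutes with the commutant.\<close>

definition hom_vec :: "real \<Rightarrow> real \<Rightarrow> 'h set" where
  "hom_vec i j = {X e\<^sub>0 | X. \<exists>X'. adjoint_pair X X' \<and>
     (\<forall>x k l. x \<in> H k l \<longrightarrow> X' x \<in> H (k - i) (l - j)) \<and>
     (\<forall>S x. commuting S \<longrightarrow> S (X x) = X (S x))}"

lemma hom_vecI:
  assumes "X e\<^sub>0 = v" "adjoint_pair X X'" "\<And>x k l. x \<in> H k l \<Longrightarrow> X' x \<in> H (k - i) (l - j)"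
    "\<And>S x. commuting S \<Longrightarrow> S (X x) = X (S x)"
  shows "v \<in> hom_vec i j"
  unfolding hom_vec_def using assms
  by (intro CollectI exI[of _ X] exI[of _ X'] conjI allI impI) simp_all

lemma hom_vecE:
  assumes "v \<in> hom_vec i j"
  obtains X X' where "X e\<^sub>0 = v" "adjoint_pair X X'" "\<forall>x k l. x \<in> H k l \<longrightarrow> X' x \<in> H (k - i) (l - j)"
    "\<forall>S x. commuting S \<longrightarrow> S (X x) = X (S x)"
  using assms unfolding hom_vec_def by (elim CollectE exE conjE) simp

lemma commuting_bounded: "commuting S \<Longrightarrow> bounded_op S"
  by (simp add: commuting_def)

lemma hom_vec_zero: "0 \<in> hom_vec i j"
  by (rule hom_vecI[of "\<lambda>_. 0" _ "\<lambda>_. 0"])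
    (auto simp: adjoint_pair_def H_zero bounded_op_zero commuting_bounded)

lemma hom_vec_scaleR_add:
  assumes v: "v \<in> hom_vec i j" and w: "w \<in> hom_vec i j"
  shows "r *\<^sub>R v + s *\<^sub>R w \<in> hom_vec i j"
proof -
  obtain X X' where X: "X e\<^sub>0 = v" "adjoint_pair X X'" "\<forall>x k l. x \<in> H k l \<longrightarrow> X' x \<in> H (k - i) (l - j)"
    "\<forall>S x. commuting S \<longrightarrow> S (X x) = X (S x)" by (rule hom_vecE[OF v])
  obtain Y Y' where Y: "Y e\<^sub>0 = w" "adjoint_pair Y Y'" "\<forall>x k l. x \<in> H k l \<longrightarrow> Y' x \<in> H (k - i) (l - j)"
    "\<forall>S x. commuting S \<longrightarrow> S (Y x) = Y (S x)" by (rule hom_vecE[OF w])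
  show ?thesis
  proof (rule hom_vecI[of "\<lambda>x. r *\<^sub>R X x + s *\<^sub>R Y x" _ "\<lambda>x. r *\<^sub>R X' x + s *\<^sub>R Y' x"])
    show "adjoint_pair (\<lambda>x. r *\<^sub>R X x + s *\<^sub>R Y x) (\<lambda>x. r *\<^sub>R X' x + s *\<^sub>R Y' x)"
      using X(2) Y(2) by (simp add: adjoint_pair_def cinner_add_left cinner_add_right
          cinner_scaleR_left cinner_scaleR_right)
    show "r *\<^sub>R X' x + s *\<^sub>R Y' x \<in> H (k - i) (l - j)" if "x \<in> H k l" for x k l
      unfolding scaleC_of_real[symmetric] by (intro H_add H_scaleC X(3)[rule_format] Y(3)[rule_format] that)
    show "S (r *\<^sub>R X x + s *\<^sub>R Y x) = r *\<^sub>R X (S x) + s *\<^sub>R Y (S x)" if "commuting S" for S x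
      using that by (simp add: X(4) Y(4) bounded_op_add bounded_op_scaleR commuting_bounded)
  qed (simp add: X(1) Y(1))
qed

lemma hom_vec_apply:
  assumes "adjoint_pair G G'" "\<And>x k l. x \<in> H k l \<Longrightarrow> G' x \<in> H (k - c) (l - d)"
    and "\<And>S x. commuting S \<Longrightarrow> S (G x) = G (S x)" and v: "v \<in> hom_vec i j"
  shows "G v \<in> hom_vec (i + c) (j + d)"
proof -
  obtain X X' where X: "X e\<^sub>0 = v" "adjoint_pair X X'" "\<forall>x k l. x \<in> H k l \<longrightarrow> X' x \<in> H (k - i) (l - j)"
    "\<forall>S x. commuting S \<longrightarrow> S (X x) = X (S x)" by (rule hom_vecE[OF v])
  show ?thesis
  proof (rule hom_vecI[of "\<lambda>x. G (X x)" _ "\<lambda>x. X' (G' x)"])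
    show "X' (G' x) \<in> H (k - (i + c)) (l - (j + d))" if "x \<in> H k l" for x k l
      using X(3)[rule_format, OF assms(2)[OF that]] by (simp add: algebra_simps)
  qed (use X assms in \<open>simp_all add: adjoint_pair_comp\<close>)
qed

lemma hom_vec_a: "v \<in> hom_vec i j \<Longrightarrow> a v \<in> hom_vec (i - 1/2) (j - 1/2)"
  using hom_vec_apply[OF adj_a, of "- (1/2)" "- (1/2)" v i j] a'_H by (simp add: commuting_def)

lemma hom_vec_a': "v \<in> hom_vec i j \<Longrightarrow> a' v \<in> hom_vec (i + 1/2) (j + 1/2)"
  using hom_vec_apply[OF adj_a', of "1/2" "1/2" v i j] a_H by (simp add: commuting_def)

lemma hom_vec_b: "v \<in> hom_vec i j \<Longrightarrow> b v \<in> hom_vec (i + 1/2) (j - 1/2)"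
  using hom_vec_apply[OF adj_b, of "1/2" "- (1/2)" v i j] b'_H by (simp add: commuting_def)

lemma hom_vec_b': "v \<in> hom_vec i j \<Longrightarrow> b' v \<in> hom_vec (i - 1/2) (j + 1/2)"
  using hom_vec_apply[OF adj_b', of "- (1/2)" "1/2" v i j] b_H by (simp add: commuting_def)

lemma hom_vec_solve:
  assumes "p \<noteq> 0" "u = p *\<^sub>R v + m *\<^sub>R w" "u \<in> hom_vec i j" "w \<in> hom_vec i j"
  shows "v \<in> hom_vec i j"
proof -
  have "v = (1 / p) *\<^sub>R u + (- m / p) *\<^sub>R w" using assms(1,2) by (simp add: scaleR_add_right)
  then show ?thesis using hom_vec_scaleR_add[OF assms(3,4), of "1 / p" "- m / p"] by simp
qed

lemma one_minus_powr_pos: "0 < x \<Longrightarrow> 0 < 1 - q powr x"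
  using q_pos q_less_1 by (simp add: powr_def mult_pos_neg)

text \<open>Depending on which of \<open>i = \<plusminus>(n + 1/2)\<close>, \<open>j = n + 1/2\<close> hold, one of \<open>a\<close>, \<open>b\<close>, \<open>a'\<close>, \<open>b'\<close> maps some
  \<open>e(n, i', j')\<close> to a nonzero multiple of \<open>e(n + 1/2, i, j)\<close> plus a multiple of \<open>e(n - 1/2, i, j)\<close>.\<close>

lemma e_in_hom_vec:
  "k \<le> N \<Longrightarrow> l \<le> N \<Longrightarrow>
     e (real N / 2, - (real N / 2) + real k, - (real N / 2) + real l)
       \<in> hom_vec (- (real N / 2) + real k) (- (real N / 2) + real l)"
proof (induction N arbitrary: k l rule: less_induct)
  case (less N)
  show ?case
  proof (cases N)
    case 0
    have "e\<^sub>0 \<in> hom_vec 0 0"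
      by (rule hom_vecI[of id _ id]) (auto simp: adjoint_pair_def)
    with 0 less.prems show ?thesis by simp
  next
    case (Suc M)
    define n where "n = real M / 2"
    define i where "i = - n - 1/2 + real k"
    define j where "j = - n - 1/2 + real l"
    have eqs: "real N / 2 = n + 1/2" "- (n + 1/2) + real k = i" "- (n + 1/2) + real l = j"
      by (simp_all add: n_def i_def j_def Suc add_divide_distrib)
    have IH: "e (n, i', j') \<in> hom_vec i' j'" and IH_spin: "(n, i', j') \<in> spin_index"
      if "k' \<le> M" "l' \<le> M" "i' = - n + real k'" "j' = - n + real l'" for i' j' k' l'
      using less.IH[of M k' l'] that unfolding n_def spin_index_iff by (auto simp: Suc)
    have nij: "(n + 1/2, i, j) \<in> spin_index"
      unfolding spin_index_iff using less.prems eqs by (intro exI[of _ N] exI[of _ k] exI[of _ l]) auto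
    then have bv: "basis_vec e (n + 1/2) i j = e (n + 1/2, i, j)" by (simp add: basis_vec_def)
    have lower: "basis_vec e (n - 1/2) i j \<in> hom_vec i j"
    proof (cases "(n - 1/2, i, j) \<in> spin_index")
      case True
      then obtain N' k' l' where *: "k' \<le> N'" "l' \<le> N'" "n - 1/2 = real N' / 2"
        "i = - (n - 1/2) + real k'" "j = - (n - 1/2) + real l'" unfolding spin_index_iff by blast
      then have "N' < N" by (simp add: n_def Suc field_simps)
      from less.IH[OF this *(1,2), folded *(3), folded *(4,5)] True show ?thesis
        by (simp add: basis_vec_def)
    qed (simp add: basis_vec_def hom_vec_zero)
    have n0: "n \<ge> 0" by (simp add: n_def)
    consider "k \<le> M" "l \<le> M" | "k = Suc M" "l \<le> M" | "l = Suc M" "k \<noteq> 0" | "l = Suc M" "k = 0"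
      using less.prems Suc by linarith
    then have "e (n + 1/2, i, j) \<in> hom_vec i j"
    proof cases
      case 1
      let ?v = "e (n, i + 1/2, j + 1/2)"
      have v: "?v \<in> hom_vec (i + 1/2) (j + 1/2)" and sv: "(n, i + 1/2, j + 1/2) \<in> spin_index"
        by (rule IH[OF 1] IH_spin[OF 1]; simp add: i_def j_def)+
      have "i + 1/2 \<le> n" "j + 1/2 \<le> n" using 1 by (simp_all add: i_def j_def n_def)
      then have "a_plus q n (i + 1/2) (j + 1/2) \<noteq> 0"
        using q_pos n0 one_minus_powr_pos[of "2 * n - 2 * (j + 1/2) + 2"]
          one_minus_powr_pos[of "2 * n - 2 * (i + 1/2) + 2"]
          one_minus_powr_pos[of "4 * n + 2"] one_minus_powr_pos[of "4 * n + 4"]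
        by (simp add: a_plus_def)
      moreover have "a ?v = a_plus q n (i + 1/2) (j + 1/2) *\<^sub>R e (n + 1/2, i, j) +
          a_minus q n (i + 1/2) (j + 1/2) *\<^sub>R basis_vec e (n - 1/2) i j"
        using a_e[OF sv] by (simp add: bv)
      moreover have "a ?v \<in> hom_vec i j" using hom_vec_a[OF v] by simp
      ultimately show ?thesis by (rule hom_vec_solve[OF _ _ _ lower])
    next
      case 2
      let ?v = "e (n, i - 1/2, j + 1/2)"
      have v: "?v \<in> hom_vec (i - 1/2) (j + 1/2)" and sv: "(n, i - 1/2, j + 1/2) \<in> spin_index"
        by (rule IH[of M l] IH_spin[of M l]; use 2 in \<open>simp add: i_def j_def n_def\<close>)+
      have "i - 1/2 = n" "j + 1/2 \<le> n" using 2 by (simp_all add: i_def j_def n_def)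
      then have "b_plus q n (i - 1/2) (j + 1/2) \<noteq> 0"
        using q_pos n0 one_minus_powr_pos[of "2 * n - 2 * (j + 1/2) + 2"]
          one_minus_powr_pos[of "2 * n + 2 * (i - 1/2) + 2"]
          one_minus_powr_pos[of "4 * n + 2"] one_minus_powr_pos[of "4 * n + 4"]
        by (simp add: b_plus_def)
      moreover have "b ?v = b_plus q n (i - 1/2) (j + 1/2) *\<^sub>R e (n + 1/2, i, j) +
          b_minus q n (i - 1/2) (j + 1/2) *\<^sub>R basis_vec e (n - 1/2) i j"
        using b_e[OF sv] by (simp add: bv)
      moreover have "b ?v \<in> hom_vec i j" using hom_vec_b[OF v] by simp
      ultimately show ?thesis by (rule hom_vec_solve[OF _ _ _ lower])
    next
      case 3
      let ?v = "e (n, i - 1/2, j - 1/2)"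
      have v: "?v \<in> hom_vec (i - 1/2) (j - 1/2)" and sv: "(n, i - 1/2, j - 1/2) \<in> spin_index"
        by (rule IH[of "k - 1" M] IH_spin[of "k - 1" M];
            use 3 less.prems Suc in \<open>simp add: i_def j_def n_def of_nat_diff\<close>)+
      have "i + 1/2 > - n" "j - 1/2 = n" using 3 by (simp_all add: i_def j_def n_def)
      then have "a_minus q (n + 1/2) i j \<noteq> 0"
        using q_pos n0 one_minus_powr_pos[of "2 * (n + 1/2) + 2 * j"]
          one_minus_powr_pos[of "2 * (n + 1/2) + 2 * i"]
          one_minus_powr_pos[of "4 * (n + 1/2)"] one_minus_powr_pos[of "4 * (n + 1/2) + 2"]
        by (simp add: a_minus_def)
      moreover have "a' ?v = a_minus q (n + 1/2) i j *\<^sub>R e (n + 1/2, i, j) +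
          a_plus q (n - 1/2) i j *\<^sub>R basis_vec e (n - 1/2) i j"
        using a'_e[OF sv] by (simp add: bv)
      moreover have "a' ?v \<in> hom_vec i j" using hom_vec_a'[OF v] by simp
      ultimately show ?thesis by (rule hom_vec_solve[OF _ _ _ lower])
    next
      case 4
      let ?v = "e (n, i + 1/2, j - 1/2)"
      have v: "?v \<in> hom_vec (i + 1/2) (j - 1/2)" and sv: "(n, i + 1/2, j - 1/2) \<in> spin_index"
        by (rule IH[of 0 M] IH_spin[of 0 M]; use 4 in \<open>simp add: i_def j_def n_def\<close>)+
      have "i + 1/2 = - n" "j - 1/2 = n" using 4 by (simp_all add: i_def j_def n_def)
      then have "b_minus q (n + 1/2) i j \<noteq> 0"
        using q_pos n0 one_minus_powr_pos[of "2 * (n + 1/2) + 2 * j"]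
          one_minus_powr_pos[of "2 * (n + 1/2) - 2 * i"]
          one_minus_powr_pos[of "4 * (n + 1/2)"] one_minus_powr_pos[of "4 * (n + 1/2) + 2"]
        by (simp add: b_minus_def)
      moreover have "b' ?v = b_minus q (n + 1/2) i j *\<^sub>R e (n + 1/2, i, j) +
          b_plus q (n - 1/2) i j *\<^sub>R basis_vec e (n - 1/2) i j"
        using b'_e[OF sv] by (simp add: bv)
      moreover have "b' ?v \<in> hom_vec i j" using hom_vec_b'[OF v] by simp
      ultimately show ?thesis by (rule hom_vec_solve[OF _ _ _ lower])
    qed
    then show ?thesis unfolding eqs .
  qed
qed

text \<open>If \<open>T' e\<^sub>0\<close> has no component of weight \<open>(-i, -j)\<close>, then \<open>T e\<^sub>0\<close> has none of weight \<open>(i, j)\<close>.\<close>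

lemma cinner_e_commuting_dual:
  assumes nij: "(n, i, j) \<in> spin_index"
    and T': "commuting T'" and adj: "adjoint_pair T T'"
    and dual: "\<And>y. y \<in> H (- i) (- j) \<Longrightarrow> cinner (T' e\<^sub>0) y = 0"
  shows "cinner (e (n, i, j)) (T e\<^sub>0) = 0"
proof -
  obtain N k l :: nat where *: "k \<le> N" "l \<le> N" "n = real N / 2" "i = - n + real k" "j = - n + real l"
    using nij unfolding spin_index_iff by blast
  have "e (n, i, j) \<in> hom_vec i j"
    using e_in_hom_vec[OF *(1,2)] unfolding *(3)[symmetric] *(4,5)[symmetric] .
  then obtain X X' where X: "X e\<^sub>0 = e (n, i, j)" "adjoint_pair X X'"
    "\<forall>x k l. x \<in> H k l \<longrightarrow> X' x \<in> H (k - i) (l - j)"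
    "\<forall>S x. commuting S \<longrightarrow> S (X x) = X (S x)" by (rule hom_vecE)
  have "cinner (X e\<^sub>0) (T e\<^sub>0) = cinner (T' (X e\<^sub>0)) e\<^sub>0"
    using adjoint_pair_sym[OF adj] by (simp add: adjoint_pair_def)
  also have "T' (X e\<^sub>0) = X (T' e\<^sub>0)"
    using X(4) T' by blast
  also have "cinner (X (T' e\<^sub>0)) e\<^sub>0 = cinner (T' e\<^sub>0) (X' e\<^sub>0)"
    using X(2) by (simp add: adjoint_pair_def)
  also have "\<dots> = 0"
    using X(3)[rule_format, OF e_in_H[OF spin_index_0]] by (intro dual) simp
  finally show ?thesis unfolding X(1) .
qed

section \<open>Asymptotic eigenvectors of \<open>F\<close>\<close>

lemma a'_pow_small_imp_0:
  assumes "\<And>r. 0 < r \<Longrightarrow> \<exists>n. norm ((a' ^^ n) v) < r"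
  shows "v = 0"
proof (rule a'_pow_tendsto_0_imp, rule LIMSEQ_I)
  fix r :: real assume "0 < r"
  then obtain n where "norm ((a' ^^ n) v) < r" using assms by blast
  then show "\<exists>n. \<forall>m\<ge>n. norm ((a' ^^ m) v - 0) < r"
    using order.strict_trans1[OF norm_a'_pow_antimono] by (intro exI[of _ n]) simp
qed

text \<open>If the defect \<open>F a'\<^sup>N x + a'\<^sup>N x\<close> tends to zero, then it does so for the component \<open>z\<close> of \<open>x\<close> in each
  weight space, because \<open>F\<close> preserves the weight spaces and \<open>a'\<^sup>N\<close> maps distinct ones into distinct, hence
  orthogonal, ones.\<close>

lemma defect_weight_component:
  assumes lim: "(\<lambda>N. F ((a' ^^ N) x) + (a' ^^ N) x) \<longlonglongrightarrow> 0"
    and z: "z \<in> H i j" and orth: "\<And>y. y \<in> H i j \<Longrightarrow> cinner y (x - z) = 0"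
  shows "(\<lambda>N. F ((a' ^^ N) z) + (a' ^^ N) z) \<longlonglongrightarrow> 0"
proof -
  have "norm (F ((a' ^^ N) z) + (a' ^^ N) z) \<le> norm (F ((a' ^^ N) x) + (a' ^^ N) x)" for N
  proof -
    let ?G = "\<lambda>y. F ((a' ^^ N) y) + (a' ^^ N) y"
    have bdd: "bounded_op (a' ^^ N)" by (rule bounded_op_funpow[OF bounded_a'])
    have "(a' ^^ N) z \<in> H (i + real N / 2) (j + real N / 2)" by (rule a'_pow_H[OF z])
    then have Gz: "?G z \<in> H (i + real N / 2) (j + real N / 2)" by (intro H_add F_H)
    have 0: "inner y ((a' ^^ N) (x - z)) = 0" if "y \<in> H (i + real N / 2) (j + real N / 2)" for y
    proof -
      have "(a ^^ N) y \<in> H i j" using a_pow_H[OF that, of N] by simp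
      from orth[OF this] have "inner ((a ^^ N) y) (x - z) = 0" by (simp add: inner_eq_Re_cinner)
      then show ?thesis using adjoint_pair_inner[OF adjoint_pair_funpow[OF adj_a]] by simp
    qed
    have "inner (?G z) (?G (x - z)) = 0"
      using 0[OF Gz] 0[OF F_H[OF Gz]]
      by (simp add: inner_add_right flip: adjoint_pair_inner[OF adj_F])
    moreover have "?G x = ?G z + ?G (x - z)"
      by (simp add: bounded_op_diff[OF bdd] bounded_op_diff[OF bounded_F])
    ultimately have "(norm (?G x))\<^sup>2 = (norm (?G z))\<^sup>2 + (norm (?G (x - z)))\<^sup>2"
      by (simp add: norm_add_Pythagorean orthogonal_def)
    then have "(norm (?G z))\<^sup>2 \<le> (norm (?G x))\<^sup>2" by simp
    then show ?thesis by simp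
  qed
  then show ?thesis
    by (intro Lim_null_comparison[OF _ tendsto_norm_zero[OF lim]] always_eventually allI)
qed

text \<open>For \<open>i < j\<close> there is no \<open>e(n, i + N/2, j + N/2)\<close> with \<open>n = i + N/2\<close>, so \<open>F\<close> is the identity on the
  weight space and the defect of \<open>z\<close> is \<open>2 a'\<^sup>N z\<close>.\<close>

lemma defect_imp_orthogonal:
  assumes lim: "(\<lambda>N. F ((a' ^^ N) x) + (a' ^^ N) x) \<longlonglongrightarrow> 0" and "i < j"
    and y: "y \<in> H i j"
  shows "cinner y x = 0"
proof -
  obtain z where z: "z \<in> H i j" "\<And>y. y \<in> H i j \<Longrightarrow> cinner y (x - z) = 0"
    by (rule orthogonal_decomposition[OF csubspace_H closed_H, where x = x]) blast
  have "F ((a' ^^ N) z) = (a' ^^ N) z" for N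
  proof (rule F_fixes_H[OF _ a'_pow_H[OF z(1)]])
    show "(i + real N / 2, i + real N / 2, j + real N / 2) \<notin> spin_index"
      using \<open>i < j\<close> spin_index_bounds(2) by fastforce
  qed
  then have "(\<lambda>N. 2 *\<^sub>R (a' ^^ N) z) \<longlonglongrightarrow> 0"
    using defect_weight_component[OF lim z] by (simp add: scaleR_2)
  then have "(\<lambda>N. (1 / 2) *\<^sub>R 2 *\<^sub>R (a' ^^ N) z) \<longlonglongrightarrow> (1 / 2) *\<^sub>R 0"
    by (rule tendsto_scaleR[OF tendsto_const])
  then have "z = 0" by (intro a'_pow_tendsto_0_imp) simp
  with z(2)[OF y] show ?thesis by simp
qed

text \<open>On the weight space of \<open>(i, i)\<close> with \<open>i = (N + M)/2\<close>, \<open>F\<close> is the reflection in the hyperplane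
  orthogonal to \<open>e(i, i, i)\<close>, a multiple of \<open>a'\<^sup>N a'\<^sup>M e\<^sub>0\<close>. So \<open>a'\<^sup>N z - \<mu>\<^sub>N a'\<^sup>N a'\<^sup>M e\<^sub>0\<close> tends to zero for suitable
  \<open>\<mu>\<^sub>N\<close>. These are bounded, and for a limit point \<open>l\<close> the vector \<open>z - l a'\<^sup>M e\<^sub>0\<close> is zero.\<close>

lemma defect_imp_multiple:
  assumes lim: "(\<lambda>N. F ((a' ^^ N) x) + (a' ^^ N) x) \<longlonglongrightarrow> 0"
  obtains \<mu> where "\<And>y. y \<in> H (real M / 2) (real M / 2) \<Longrightarrow> cinner y (x - \<mu> *\<^sub>C (a' ^^ M) e\<^sub>0) = 0"
proof -
  let ?h = "real M / 2" and ?g = "(a' ^^ M) e\<^sub>0"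
  obtain z where z: "z \<in> H ?h ?h" "\<And>y. y \<in> H ?h ?h \<Longrightarrow> cinner y (x - z) = 0"
    by (rule orthogonal_decomposition[OF csubspace_H closed_H, where x = x]) blast
  have "\<exists>\<mu>. (F ((a' ^^ N) z) + (a' ^^ N) z) = 2 *\<^sub>R ((a' ^^ N) z - \<mu> *\<^sub>C (a' ^^ N) ?g)" for N
  proof -
    let ?i = "real (N + M) / 2"
    have i: "?h + real N / 2 = ?i" by (simp add: add_divide_distrib)
    obtain c where c: "(a' ^^ (N + M)) e\<^sub>0 = c *\<^sub>R e (?i, ?i, ?i)" by (rule a'_pow_e0)
    have "e\<^sub>0 \<noteq> 0" using norm_e0 by auto
    then have "c \<noteq> 0" using c a'_pow_eq_0_iff[of "N + M" "e\<^sub>0"] by auto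
    then have "e (?i, ?i, ?i) = (1 / c) *\<^sub>R (a' ^^ N) ?g"
      using c by (simp add: funpow_add)
    then have "cinner (e (?i, ?i, ?i)) ((a' ^^ N) z) *\<^sub>C e (?i, ?i, ?i) =
        (cinner (e (?i, ?i, ?i)) ((a' ^^ N) z) * complex_of_real (1 / c)) *\<^sub>C (a' ^^ N) ?g"
      unfolding scaleC_scaleC[symmetric] scaleC_of_real by simp
    moreover have "(a' ^^ N) z \<in> H ?i ?i" using a'_pow_H[OF z(1), of N] unfolding i .
    ultimately show ?thesis
      using F_reflects_H[OF spin_index_diag] by metis
  qed
  then obtain \<mu> where \<mu>: "\<And>N. F ((a' ^^ N) z) + (a' ^^ N) z = 2 *\<^sub>R ((a' ^^ N) z - \<mu> N *\<^sub>C (a' ^^ N) ?g)"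
    by metis
  define d where "d N = (a' ^^ N) z - \<mu> N *\<^sub>C (a' ^^ N) ?g" for N
  have "(\<lambda>N. (1 / 2) *\<^sub>R 2 *\<^sub>R d N) \<longlonglongrightarrow> (1 / 2) *\<^sub>R 0"
    using defect_weight_component[OF lim z] unfolding \<mu> d_def by (rule tendsto_scaleR[OF tendsto_const])
  then have d: "d \<longlonglongrightarrow> 0" by simp
  have "?g \<noteq> 0" using norm_e0 a'_pow_eq_0_iff[of M "e\<^sub>0"] by auto
  then obtain \<delta> where \<delta>: "0 < \<delta>" "\<And>N. \<delta> \<le> norm ((a' ^^ N) ?g)"
    using a'_pow_small_imp_0[of ?g] not_less by metis
  obtain B where B: "\<And>N. norm (d N) \<le> B"
    using convergent_imp_Bseq[of d] d by (auto simp: convergent_def Bseq_def)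
  have "norm (\<mu> N) \<le> (norm z + B) / \<delta>" for N
  proof -
    have "norm (\<mu> N) * \<delta> \<le> norm (\<mu> N *\<^sub>C (a' ^^ N) ?g)"
      unfolding norm_scaleC_chilbert by (intro mult_left_mono \<delta>(2)) simp
    also have "\<mu> N *\<^sub>C (a' ^^ N) ?g = (a' ^^ N) z - d N" by (simp add: d_def)
    also have "norm \<dots> \<le> norm z + B"
      by (rule order.trans[OF norm_triangle_ineq4]) (intro add_mono norm_a'_pow_le B)
    finally show ?thesis using \<delta>(1) by (simp add: field_simps)
  qed
  then have "bounded (range \<mu>)" by (auto simp: bounded_iff)
  then obtain l r where r: "strict_mono r" "(\<mu> \<circ> r) \<longlonglongrightarrow> l"
    using bounded_imp_convergent_subsequence by blast
  have bdd: "bounded_op (a' ^^ N)" for N by (rule bounded_op_funpow[OF bounded_a'])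
  have "z - l *\<^sub>C ?g = 0"
  proof (rule a'_pow_small_imp_0)
    fix \<epsilon> :: real assume \<epsilon>: "0 < \<epsilon>"
    have "(\<lambda>k. norm (d (r k)) + norm (\<mu> (r k) - l) * norm ?g) \<longlonglongrightarrow> norm (0 :: 'h) + norm (l - l) * norm ?g"
      using r LIMSEQ_subseq_LIMSEQ[OF d r(1)] unfolding o_def by (intro tendsto_intros)
    then have "(\<lambda>k. norm (d (r k)) + norm (\<mu> (r k) - l) * norm ?g) \<longlonglongrightarrow> 0" by simp
    then have "\<forall>\<^sub>F k in sequentially. norm (d (r k)) + norm (\<mu> (r k) - l) * norm ?g < \<epsilon>"
      by (rule order_tendstoD(2)[OF _ \<epsilon>])
    then obtain k where k: "norm (d (r k)) + norm (\<mu> (r k) - l) * norm ?g < \<epsilon>"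
      by (auto simp: eventually_sequentially)
    have "(a' ^^ r k) (z - l *\<^sub>C ?g) = d (r k) + (\<mu> (r k) - l) *\<^sub>C (a' ^^ r k) ?g"
      by (simp add: d_def bounded_op_diff[OF bdd] bounded_op_scaleC[OF bdd] scaleC_diff_left)
    also have "norm \<dots> \<le> norm (d (r k)) + norm (\<mu> (r k) - l) * norm ?g"
      by (rule order.trans[OF norm_triangle_ineq])
        (auto simp: norm_scaleC_chilbert intro!: mult_left_mono norm_a'_pow_le)
    finally show "\<exists>n. norm ((a' ^^ n) (z - l *\<^sub>C ?g)) < \<epsilon>" using k by (intro exI[of _ "r k"]) simp
  qed
  with z(2) have "cinner y (x - l *\<^sub>C ?g) = 0" if "y \<in> H ?h ?h" for y using that by simp
  then show ?thesis by (rule that)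
qed

end

section \<open>Operators in the commutant\<close>

text \<open>An operator \<open>T\<close> in the commutant, with adjoint \<open>T'\<close>. Compactness of the commutator with \<open>F\<close> enters
  through its effect on weakly null sequences, which makes the assumptions symmetric in \<open>T\<close> and \<open>T'\<close>.\<close>

locale SUq2_commuting = SUq2_basis q a a' b b' e F
  for q a and a' b b' :: "'h::chilbert_space \<Rightarrow> 'h" and e F +
  fixes T T' :: "'h \<Rightarrow> 'h"
  assumes commuting_T: "commuting T" and commuting_T': "commuting T'"
    and adj_T: "adjoint_pair T T'"
    and null_T: "(\<And>n. norm (x n) \<le> 1) \<Longrightarrow> (\<And>y. (\<lambda>n. inner y (x n)) \<longlonglongrightarrow> 0) \<Longrightarrow>
      (\<lambda>n. commutator F T (x n)) \<longlonglongrightarrow> 0"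
    and null_T': "(\<And>n. norm (x n) \<le> 1) \<Longrightarrow> (\<And>y. (\<lambda>n. inner y (x n)) \<longlonglongrightarrow> 0) \<Longrightarrow>
      (\<lambda>n. commutator F T' (x n)) \<longlonglongrightarrow> 0"
begin

lemma adjoint_commuting: "SUq2_commuting q a a' b b' e F T' T"
  by unfold_locales (intro commuting_T commuting_T' adjoint_pair_sym[OF adj_T] null_T null_T'; simp)+

lemma T_a'_pow: "T ((a' ^^ N) x) = (a' ^^ N) (T x)"
  using commuting_T by (induction N) (auto simp: commuting_def)

lemma T_b_pow: "T ((b ^^ N) x) = (b ^^ N) (T x)"
  using commuting_T by (induction N) (auto simp: commuting_def)

lemma T'_a_pow: "T' ((a ^^ N) x) = (a ^^ N) (T' x)"
  using commuting_T' by (induction N) (auto simp: commuting_def)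

lemma T'_b_pow: "T' ((b ^^ N) x) = (b ^^ N) (T' x)"
  using commuting_T' by (induction N) (auto simp: commuting_def)

lemma T_minus: "T (- x) = - T x"
  using bounded_op_scaleR[OF commuting_bounded[OF commuting_T], of "-1" x] by simp

lemma a'_pow_defect: "(\<lambda>N. F ((a' ^^ N) (T e\<^sub>0)) + (a' ^^ N) (T e\<^sub>0)) \<longlonglongrightarrow> 0"
proof -
  have "(\<lambda>N. commutator F T ((a' ^^ N) e\<^sub>0)) \<longlonglongrightarrow> 0"
    using norm_a'_pow_le[of _ "e\<^sub>0"] norm_e0 by (intro null_T weakly_null_a'_pow) simp
  then show ?thesis by (simp add: commutator_def F_a'_pow_e0 T_minus T_a'_pow)
qed

lemma b_pow_defect: "(\<lambda>N. F ((b ^^ N) (T e\<^sub>0)) + (b ^^ N) (T e\<^sub>0)) \<longlonglongrightarrow> 0"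
proof -
  have "(\<lambda>N. commutator F T ((b ^^ N) e\<^sub>0)) \<longlonglongrightarrow> 0"
    using norm_b_pow_le[of _ "e\<^sub>0"] norm_e0 by (intro null_T weakly_null_b_pow) simp
  then show ?thesis by (simp add: commutator_def F_b_pow_e0 T_minus T_b_pow)
qed

text \<open>For \<open>M > 0\<close> the vector \<open>b\<^sup>N a\<^sup>M e\<^sub>0\<close> has weight \<open>(i, j)\<close> with \<open>i = (N - M)/2\<close> and \<open>j = -(N + M)/2\<close>. As
  \<open>\<bar>j\<bar> > i\<close>, it is fixed by \<open>F\<close>, whereas the pairing below would detect a component \<open>\<nu> a'\<^sup>M e\<^sub>0\<close> of
  \<open>T' e\<^sub>0\<close>.\<close>

lemma adjoint_coefficient_0:
  assumes M: "0 < M"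
    and \<nu>: "\<And>y. y \<in> H (real M / 2) (real M / 2) \<Longrightarrow> cinner y (T' e\<^sub>0 - \<nu> *\<^sub>C (a' ^^ M) e\<^sub>0) = 0"
  shows "\<nu> = 0"
proof -
  let ?v = "\<lambda>N. (b ^^ N) ((a ^^ M) e\<^sub>0)" and ?x = "\<lambda>N. (b ^^ N) (T e\<^sub>0)"
  let ?s = "\<lambda>N. cinner (?v N) (F (?x N) + ?x N)"
  have lim: "(\<lambda>N. norm ((a ^^ M) e\<^sub>0) * norm (F (?x N) + ?x N)) \<longlonglongrightarrow> 0"
    by (rule tendsto_mult_right_zero[OF tendsto_norm_zero[OF b_pow_defect]])
  have le: "norm (?s N) \<le> norm ((a ^^ M) e\<^sub>0) * norm (F (?x N) + ?x N)" for N
    by (rule order.trans[OF norm_cinner_le]) (intro mult_right_mono norm_b_pow_le norm_ge_zero)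
  have s: "?s \<longlonglongrightarrow> 0"
    by (rule Lim_null_comparison[OF always_eventually[OF allI[OF le]] lim])
  have s_ge: "2 * norm \<nu> * (1 - q\<^sup>2) ^ Suc M \<le> norm (?s N)" for N
  proof -
    let ?y = "(a' ^^ M) ((b' ^^ N) ((b ^^ N) e\<^sub>0))"
    have "(a ^^ M) e\<^sub>0 \<in> H (0 - real M / 2) (0 - real M / 2)"
      by (rule a_pow_H[OF e_in_H[OF spin_index_0]])
    from b_pow_H[OF this, of N] have Fv: "F (?v N) = ?v N"
    proof (rule F_fixes_H[rotated])
      show "(0 - real M / 2 + real N / 2, 0 - real M / 2 + real N / 2, 0 - real M / 2 - real N / 2)
          \<notin> spin_index"
        using M spin_index_bounds(2)[of "0 - real M / 2 + real N / 2" "0 - real M / 2 + real N / 2"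
            "0 - real M / 2 - real N / 2"] by auto
    qed
    have "cinner (?v N) (F (?x N)) = cinner (F (?v N)) (?x N)"
      using adj_F by (simp only: adjoint_pair_def)
    then have "?s N = 2 * cinner (?v N) (?x N)"
      by (simp add: Fv cinner_add_right)
    also have "cinner (?v N) (?x N) = cinner (T' (?v N)) ((b ^^ N) e\<^sub>0)"
      using adjoint_pair_sym[OF adj_T] by (simp add: T_b_pow adjoint_pair_def)
    also have "T' (?v N) = (b ^^ N) ((a ^^ M) (T' e\<^sub>0))"
      by (simp add: T'_b_pow T'_a_pow)
    also have "cinner \<dots> ((b ^^ N) e\<^sub>0) = cinner (T' e\<^sub>0) ?y"
      using adjoint_pair_funpow[OF adj_a, of M] adjoint_pair_funpow[OF adj_b, of N]
      by (simp add: adjoint_pair_def)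
    also have "\<dots> = cnj \<nu> * cinner ((a' ^^ M) e\<^sub>0) ?y"
    proof -
      have "(b' ^^ N) ((b ^^ N) e\<^sub>0) \<in> H 0 0"
        using b'_pow_H[OF b_pow_H[OF e_in_H[OF spin_index_0]], of N N] by simp
      from a'_pow_H[OF this, of M] have "?y \<in> H (real M / 2) (real M / 2)" by simp
      from \<nu>[OF this] have "cinner ?y (T' e\<^sub>0) = \<nu> * cinner ?y ((a' ^^ M) e\<^sub>0)"
        by (simp add: cinner_diff_right cinner_scaleC_right)
      then show ?thesis by (metis cinner_commute complex_cnj_mult)
    qed
    also have "cinner ((a' ^^ M) e\<^sub>0) ?y = cinner ((b ^^ N) ((a ^^ M) ((a' ^^ M) e\<^sub>0))) ((b ^^ N) e\<^sub>0)"
      using adjoint_pair_funpow[OF adj_a, of M] adjoint_pair_funpow[OF adj_b, of N]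
      by (simp add: adjoint_pair_def)
    also have "\<dots> = cinner ((a' ^^ M) ((b ^^ N) e\<^sub>0)) ((a' ^^ M) ((b ^^ N) e\<^sub>0))"
      using adjoint_pair_funpow[OF adj_a, of M]
      by (simp add: adjoint_pair_def flip: a_pow_a'_pow_b_pow)
    also have "\<dots> = complex_of_real ((norm ((a' ^^ M) ((b ^^ N) e\<^sub>0)))\<^sup>2)" by (rule cinner_self)
    finally have "norm (?s N) = 2 * norm \<nu> * (norm ((a' ^^ M) ((b ^^ N) e\<^sub>0)))\<^sup>2"
      by (simp add: norm_mult norm_power)
    moreover have "(1 - q\<^sup>2) ^ M * (1 - q\<^sup>2) \<le> (1 - q\<^sup>2) ^ M * (norm ((b ^^ N) e\<^sub>0))\<^sup>2"
      using q2_less_1 by (intro mult_left_mono norm_b_pow_e0_ge) auto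
    ultimately show ?thesis
      using norm_a'_pow_ge[of M "(b ^^ N) e\<^sub>0"] by (auto intro!: mult_left_mono simp: mult.commute)
  qed
  have "2 * norm \<nu> * (1 - q\<^sup>2) ^ Suc M \<le> norm (0 :: complex)"
    by (rule LIMSEQ_le_const[OF tendsto_norm[OF s]]) (use s_ge in blast)
  moreover have "0 < (1 - q\<^sup>2) ^ Suc M" using q2_less_1 by (intro zero_less_power) simp
  ultimately show ?thesis by (simp add: mult_le_0_iff del: power_Suc)
qed

lemma orthogonal_below_diagonal: "i < j \<Longrightarrow> y \<in> H i j \<Longrightarrow> cinner y (T e\<^sub>0) = 0"
  by (rule defect_imp_orthogonal[OF a'_pow_defect])

lemma orthogonal_positive_diagonal:
  assumes M: "0 < M" and y: "y \<in> H (real M / 2) (real M / 2)"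
  shows "cinner y (T e\<^sub>0) = 0"
proof -
  interpret adjoint: SUq2_commuting q a a' b b' e F T' T by (rule adjoint_commuting)
  obtain \<mu> where \<mu>: "\<And>y. y \<in> H (real M / 2) (real M / 2) \<Longrightarrow> cinner y (T e\<^sub>0 - \<mu> *\<^sub>C (a' ^^ M) e\<^sub>0) = 0"
    by (rule defect_imp_multiple[OF a'_pow_defect]) blast
  have "\<mu> = 0" using adjoint.adjoint_coefficient_0[OF M \<mu>] .
  with \<mu>[OF y] show ?thesis by simp
qed

lemma T_e0: "\<exists>\<mu>. T e\<^sub>0 = \<mu> *\<^sub>C e\<^sub>0"
proof -
  interpret adjoint: SUq2_commuting q a a' b b' e F T' T by (rule adjoint_commuting)
  obtain \<mu> where \<mu>: "\<And>y. y \<in> H (real 0 / 2) (real 0 / 2) \<Longrightarrow> cinner y (T e\<^sub>0 - \<mu> *\<^sub>C (a' ^^ 0) e\<^sub>0) = 0"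
    by (rule defect_imp_multiple[OF a'_pow_defect]) blast
  have dual: "cinner (e (n, i, j)) (T e\<^sub>0) = 0"
    if "(n, i, j) \<in> spin_index" "\<And>y. y \<in> H (- i) (- j) \<Longrightarrow> cinner y (T' e\<^sub>0) = 0" for n i j
    using that(2) by (intro cinner_e_commuting_dual[OF that(1) commuting_T' adj_T])
      (metis cinner_commute complex_cnj_zero)
  have off: "cinner (e (n, i, j)) (T e\<^sub>0) = 0"
    if nij: "(n, i, j) \<in> spin_index" and "i \<noteq> 0 \<or> j \<noteq> 0" for n i j
  proof -
    consider "i < j" | "j < i" | "i = j" "0 < i" | "i = j" "i < 0"
      using \<open>i \<noteq> 0 \<or> j \<noteq> 0\<close> by linarith
    then show ?thesis
    proof cases
      case 1
      then show ?thesis by (rule orthogonal_below_diagonal[OF _ e_in_H[OF nij]])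
    next
      case 2
      then show ?thesis by (intro dual[OF nij] adjoint.orthogonal_below_diagonal) auto
    next
      case 3
      obtain N k :: nat where "i = - (real N / 2) + real k" using nij unfolding spin_index_iff by blast
      then have M: "i = real (2 * k - N) / 2" "0 < 2 * k - N"
        using \<open>0 < i\<close> by (auto simp: of_nat_diff field_simps)
      show ?thesis
        using orthogonal_positive_diagonal[OF M(2)] e_in_H[OF nij] \<open>i = j\<close> M(1) by metis
    next
      case 4
      obtain N k :: nat where "i = - (real N / 2) + real k" using nij unfolding spin_index_iff by blast
      then have M: "- i = real (N - 2 * k) / 2" "0 < N - 2 * k"
        using \<open>i < 0\<close> by (auto simp: of_nat_diff field_simps)
      show ?thesis
        using adjoint.orthogonal_positive_diagonal[OF M(2)] \<open>i = j\<close> M(1)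
        by (intro dual[OF nij]) metis
    qed
  qed
  have "T e\<^sub>0 = \<mu> *\<^sub>C e\<^sub>0"
  proof (rule basis_eqI)
    fix n i j assume nij: "(n, i, j) \<in> spin_index"
    show "cinner (e (n, i, j)) (T e\<^sub>0) = cinner (e (n, i, j)) (\<mu> *\<^sub>C e\<^sub>0)"
    proof (cases "i = 0 \<and> j = 0")
      case True
      then show ?thesis using \<mu>[of "e (n, i, j)"] e_in_H[OF nij] by (simp add: cinner_diff_right)
    next
      case False
      then show ?thesis
        using off[OF nij] by (auto simp: cinner_scaleC_right cinner_e nij spin_index_0)
    qed
  qed
  then show ?thesis ..
qed

end

section \<open>The sign of \<open>D\<close> and the cyclic vector\<close>

text \<open>On the eigenspace \<open>E\<close> of \<open>D\<close> for \<open>d \<noteq> 0\<close>, \<open>F\<close> is an involution, because \<open>F\<^sup>3 = F\<close> and \<open>F\<close> is injective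
  there, and \<open>d F\<close> is positive. This rules out the eigenvalue of \<open>F\<close> whose sign is opposite to that of \<open>d\<close>.\<close>

lemma sign_of_eigenvector:
  assumes F: "is_sign_of F X D" and D: "clinear_on X D" and X: "csubspace X"
    and v: "v \<in> X" "D v = d *\<^sub>R v" and d: "d \<noteq> 0"
  shows "F v = (if 0 < d then v else - v)"
proof -
  have bF: "bounded_op F" and F3: "\<And>x. F (F (F x)) = F x" and F0: "\<And>x. F x = 0 \<longleftrightarrow> x \<in> X \<and> D x = 0"
    and FX: "\<And>x. x \<in> X \<Longrightarrow> F x \<in> X" and DF: "\<And>x. x \<in> X \<Longrightarrow> D (F x) = F (D x)"
    and pos: "\<And>x. x \<in> X \<Longrightarrow> cinner x (F (D x)) \<in> \<real>\<^sub>\<ge>\<^sub>0"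
    using F by (auto simp: is_sign_of_def)
  define E where "E = {x \<in> X. D x = d *\<^sub>R x}"
  have subX: "subspace X" by (rule csubspace_imp_subspace[OF X])
  have D_add: "D (x + y) = D x + D y" and D_scaleR: "D (r *\<^sub>R x) = r *\<^sub>R D x"
    if "x \<in> X" "y \<in> X" for x y r
    using D that by (auto simp: clinear_on_def simp flip: scaleC_of_real)
  have E_add: "x + r *\<^sub>R y \<in> E" if "x \<in> E" "y \<in> E" for x y r
    using that subX
    by (auto simp: E_def subspace_add subspace_scale D_add D_scaleR scaleR_add_right)
  have FE: "F x \<in> E" if "x \<in> E" for x
    using that by (auto simp: E_def FX DF bounded_op_scaleR[OF bF])
  have E0: "x = 0" if "x \<in> E" "F x = 0" for x
    using that F0 d by (auto simp: E_def)
  have vE: "v \<in> E" using v by (simp add: E_def)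
  have "F (F v) + (-1) *\<^sub>R v \<in> E"
    by (rule E_add[OF FE[OF FE[OF vE]] vE])
  moreover have "F (F (F v) + (-1) *\<^sub>R v) = 0"
    by (simp add: bounded_op_diff[OF bF] F3)
  ultimately have "F (F v) + (-1) *\<^sub>R v = 0" by (rule E0)
  then have FF: "F (F v) = v" by simp
  have ev: "0 \<le> d * inner x (F x)" if "x \<in> E" for x
  proof -
    have "0 \<le> Re (cinner x (F (D x)))"
      using pos[of x] that by (simp add: E_def complex_nonneg_Reals_iff)
    then show ?thesis
      using that by (simp add: E_def bounded_op_scaleR[OF bF] flip: inner_eq_Re_cinner)
  qed
  show ?thesis
  proof (cases "0 < d")
    case True
    define z where "z = v + (-1) *\<^sub>R F v"
    have z: "z \<in> E" unfolding z_def by (rule E_add[OF vE FE[OF vE]])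
    have "F z = - z" by (simp add: z_def bounded_op_diff[OF bF] FF)
    with ev[OF z] True have "z = 0" by (simp add: mult_le_0_iff flip: power2_norm_eq_inner)
    with True show ?thesis by (simp add: z_def)
  next
    case False
    define z where "z = v + 1 *\<^sub>R F v"
    have z: "z \<in> E" unfolding z_def by (rule E_add[OF vE FE[OF vE]])
    have "F z = z" by (simp add: z_def bounded_op_add[OF bF] FF)
    with ev[OF z] False d have "z = 0" by (simp add: zero_le_mult_iff flip: power2_norm_eq_inner)
    with False show ?thesis by (simp add: z_def eq_neg_iff_add_eq_0 add.commute)
  qed
qed

lemma bounded_op_scaleC_left: "bounded_op (\<lambda>v::'h::chilbert_space. c *\<^sub>C v)"
proof -
  have "c *\<^sub>C (r *\<^sub>R v) = r *\<^sub>R (c *\<^sub>C v)" for r and v :: 'h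
    unfolding scaleC_of_real[symmetric] scaleC_scaleC by (simp add: mult.commute)
  then have "bounded_linear (\<lambda>v::'h. c *\<^sub>C v)"
    by (intro bounded_linear_intro[where K = "cmod c"])
      (auto simp: scaleC_add_right norm_scaleC_chilbert mult.commute)
  then show ?thesis
    by (simp add: bounded_op_def clinear_on_def scaleC_add_right scaleC_scaleC mult.commute)
qed

lemma star_representation_relations:
  assumes rep: "star_representation \<pi>" and rel: "SUq2_relations q \<alpha> \<beta>"
  shows "SUq2_operator_relations q (\<pi> \<alpha>) (\<pi> (star \<alpha>)) (\<pi> \<beta>) (\<pi> (star \<beta>))"
proof -
  have mult: "\<pi> x (\<pi> y v) = \<pi> (x * y) v" and plus: "\<pi> x v + \<pi> y v = \<pi> (x + y) v"
    and one: "\<pi> 1 v = v" and scale: "r *\<^sub>R \<pi> x v = \<pi> (r *\<^sub>R x) v" for x y v r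
    using rep by (auto simp: star_representation_def simp flip: scaleC_of_real)
  have "bounded_op (\<pi> x)" "adjoint_pair (\<pi> x) (\<pi> (star x))" for x
    using rep by (simp_all add: star_representation_def)
  moreover have "star \<alpha> * \<alpha> + star \<beta> * \<beta> = 1" "\<alpha> * star \<alpha> + q\<^sup>2 *\<^sub>R (\<beta> * star \<beta>) = 1"
    "\<alpha> * \<beta> = q *\<^sub>R (\<beta> * \<alpha>)" "\<alpha> * star \<beta> = q *\<^sub>R (star \<beta> * \<alpha>)" "star \<beta> * \<beta> = \<beta> * star \<beta>"
    using rel unfolding SUq2_relations_def by blast+
  ultimately show ?thesis
    unfolding SUq2_operator_relations_def mult scale plus by (metis one)
qed

lemma adjoint_commutes:
  assumes "adjoint_pair S S'" "adjoint_pair R R'" "\<And>x. S (R x) = R (S x)"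
  shows "S' (R' x) = R' (S' x)"
  using assms
  by (intro cinner_eqI) (simp add: adjoint_pair_def flip: assms(1,2)[unfolded adjoint_pair_def, rule_format])

theorem theorem4p1:
  fixes q :: real
    and \<alpha> \<beta> :: "'a::cstar_algebra"
    and h :: "'a \<Rightarrow> complex"
    and \<pi> :: "'a \<Rightarrow> 'h::chilbert_space \<Rightarrow> 'h"
    and \<Lambda> :: "'a \<Rightarrow> 'h"
    and e :: "real \<times> real \<times> real \<Rightarrow> 'h"
    and domD :: "'h set"
    and D F T :: "'h \<Rightarrow> 'h"
  assumes "0 < q" and "q < 1"
    and "universal_SUq2 TYPE('h) q \<alpha> \<beta>"
    and "haar_state q \<alpha> \<beta> h"
    and "gns_representation h \<pi> \<Lambda>"
    and "canonical_basis q \<alpha> \<beta> \<pi> \<Lambda> e"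
    and "equivariant_dirac e domD D"
    and "is_sign_of F domD D"
    and "T \<in> commutant (range \<pi>)"
    and "compact_op (commutator F T)"
  shows "\<exists>c. T = (\<lambda>x. c *\<^sub>C x)"
proof -
  have rep: "star_representation \<pi>" and \<Lambda>_dense: "closure (range \<Lambda>) = UNIV"
    and \<pi>_\<Lambda>: "\<And>x y. \<pi> x (\<Lambda> y) = \<Lambda> (x * y)"
    using assms(5) by (auto simp: gns_representation_def)
  have onb: "orthonormal_basis_on spin_index e" and e0: "e (0, 0, 0) = \<Lambda> 1"
    using assms(6) by (auto simp: canonical_basis_def)
  have bounded_\<pi>: "bounded_op (\<pi> x)" and adj_\<pi>: "adjoint_pair (\<pi> x) (\<pi> (star x))" for x
    using rep by (auto simp: star_representation_def)
  have bF: "bounded_op F" and adjF: "adjoint_pair F F"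
    using assms(8) by (auto simp: is_sign_of_def)
  have sa: "self_adjoint_on domD D"
    and D_e': "\<forall>(n, i, j) \<in> spin_index.
        e (n, i, j) \<in> domD \<and> D (e (n, i, j)) = dirac_eigenvalue n i *\<^sub>R e (n, i, j)"
    using assms(7) unfolding equivariant_dirac_def by (rule conjunct1, rule conjunct2)
  have D: "csubspace domD" "clinear_on domD D"
    using sa unfolding self_adjoint_on_def by simp_all
  have D_e: "e (n, i, j) \<in> domD" "D (e (n, i, j)) = dirac_eigenvalue n i *\<^sub>R e (n, i, j)"
    if "(n, i, j) \<in> spin_index" for n i j
    using bspec[OF D_e' that] by simp_all
  interpret SUq2_basis q "\<pi> \<alpha>" "\<pi> (star \<alpha>)" "\<pi> \<beta>" "\<pi> (star \<beta>)" e F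
  proof
    show "0 < q" "q < 1" by fact+
    show "SUq2_operator_relations q (\<pi> \<alpha>) (\<pi> (star \<alpha>)) (\<pi> \<beta>) (\<pi> (star \<beta>))"
      using star_representation_relations[OF rep] assms(3) by (auto simp: universal_SUq2_def)
    show "F (e (n, i, j)) = (if i = n then - e (n, i, j) else e (n, i, j))"
      if "(n, i, j) \<in> spin_index" for n i j
    proof -
      have "0 \<le> n" using spin_index_bounds(1)[OF that] by simp
      then have "dirac_eigenvalue n i \<noteq> 0" "0 < dirac_eigenvalue n i \<longleftrightarrow> i \<noteq> n"
        by (auto simp: dirac_eigenvalue_def)
      then show ?thesis
        using sign_of_eigenvector[OF assms(8) D(2,1), of "e (n, i, j)" "dirac_eigenvalue n i"]
          D_e[OF that] by auto
    qed
  qed (use assms(6) onb bF adjF in \<open>auto simp: canonical_basis_def\<close>)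
  have bT: "bounded_op T" and T_\<pi>: "T (\<pi> x v) = \<pi> x (T v)" for x v
    using assms(9) by (auto simp: commutant_def fun_eq_iff)
  obtain T' where bT': "bounded_op T'" and adjT: "adjoint_pair T T'"
    by (rule adjoint_exists[OF bT])
  have T'_\<pi>: "T' (\<pi> x v) = \<pi> x (T' v)" for x v
    using adjoint_commutes[of T T' "\<pi> (star x)" "\<pi> (star (star x))" v] adjT adj_\<pi>[of "star x"] T_\<pi>
    unfolding star_star by (simp only:)
  let ?K' = "\<lambda>x. T' (F x) - F (T' x)"
  have K: "compact_op (commutator F T)" by fact
  have K': "adjoint_pair (commutator F T) ?K'"
    using adjF adjT by (simp add: adjoint_pair_def commutator_def cinner_diff_left cinner_diff_right)
  have bK': "bounded_op ?K'" 
    by (rule bounded_op_sub[OF bounded_op_compose[OF bT' bF] bounded_op_compose[OF bF bT']])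
  interpret SUq2_commuting q "\<pi> \<alpha>" "\<pi> (star \<alpha>)" "\<pi> \<beta>" "\<pi> (star \<beta>)" e F T T'
  proof
    fix x :: "nat \<Rightarrow> 'h"
    assume x: "\<And>n. norm (x n) \<le> 1" "\<And>y. (\<lambda>n. inner y (x n)) \<longlonglongrightarrow> 0"
    show "(\<lambda>n. commutator F T (x n)) \<longlonglongrightarrow> 0"
      by (rule compact_op_weakly_null[OF K K' bK' x])
    have "(\<lambda>n. - ?K' (x n)) \<longlonglongrightarrow> - 0"
      by (rule tendsto_minus[OF compact_op_adjoint_weakly_null[OF K K' bK' x]])
    then show "(\<lambda>n. commutator F T' (x n)) \<longlonglongrightarrow> 0" by (simp add: commutator_def)
  qed (auto simp: commuting_def bT bT' T_\<pi> T'_\<pi> adjT)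
  obtain c where c: "T (\<Lambda> 1) = c *\<^sub>C \<Lambda> 1" using T_e0 unfolding e0 ..
  have "T v = c *\<^sub>C v" for v
  proof -
    let ?G = "\<lambda>v. T v - c *\<^sub>C v"
    have "bounded_op ?G" by (rule bounded_op_sub[OF bT bounded_op_scaleC_left])
    then have "continuous_on UNIV ?G"
      by (intro bounded_linear.continuous_on[OF _ continuous_on_id]) (simp add: bounded_op_def)
    then have "closed {v. ?G v = 0}"
      using continuous_closed_preimage_constant[of UNIV ?G 0] by simp
    moreover have "?G (\<Lambda> x) = 0" for x
    proof -
      have "\<Lambda> x = \<pi> x (\<Lambda> 1)" by (simp add: \<pi>_\<Lambda>)
      then show ?thesis by (simp add: T_\<pi> c bounded_op_scaleC[OF bounded_\<pi>] del: \<pi>_\<Lambda>)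
    qed
    ultimately have "closure (range \<Lambda>) \<subseteq> {v. ?G v = 0}"
      by (intro closure_minimal) auto
    then show ?thesis using \<Lambda>_dense by auto
  qed
  then show ?thesis by (intro exI[of _ c] ext)
qed

end
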